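(* Let $k\geq 2$ and $\mathcal{U}=\{C_2,C_4,\ldots,C_{2k}\}$, and let $\mathcal{D}_{\mathcal{U}}\subseteq\mathbb{R}^k$ be the density profile of $\mathcal{U}$. Let $$Q_{\mathcal{U}}=\{(y_2,y_4,\ldots,y_{2k})\in\mathbb{R}^k:\ y_{2i}-2y_{2i+2}+y_{2i+4}\geq 0\ (1\leq i\leq k-2),\ \ 2ky_{2k-2}-(2k-2)y_{2k}\geq 0,\ \ -2ky_2+y_{2k}\geq 0\}.$$ Then $\operatorname{trop}(\mathcal{D}_{\mathcal{U}})=Q_{\mathcal{U}}$.
   Context: All graphs are finite and simple. $C_m$ denotes the cycle on $m$ vertices, and $C_2=K_2$ is the single edge. $t(H,T)=\operatorname{hom}(H,T)/v(T)^{v(H)}$ is the homomorphism density. For a finite list of graphs $\mathcal{U}=\{H_1,\ldots,H_s\}$, the density profile $\mathcal{D}_{\mathcal{U}}$ is the closure in $\mathbb{R}^s$ of the set of vectors $(t(H_1,T),\ldots,t(H_s,T))$ over all graphs $T$. For a base $b$, $\log_b(\mathcal{D}_{\mathcal{U}})$ is the image of $\mathcal{D}_{\mathcal{U}}\cap\mathbb{R}^s_{>0}$ under the coordinatewise map $\mathbf{v}\mapsto(\log_b v_1,\ldots,\log_b v_s)$, and the tropicalization is $\operatorname{trop}(\mathcal{D}_{\mathcal{U}})=\lim_{t\to 0}\log_{1/t}(\mathcal{D}_{\mathcal{U}})$. *)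

theory Defs
  imports "HOL-Analysis.Analysis" "Graph_Theory.Pair_Digraph"
begin

text \<open>
  Finite simple graphs are the elements of \<^locale>\<open>pair_graph\<close>: finite, loop-free digraphs
  with a symmetric arc relation, so that every undirected edge is a pair of opposite arcs.
\<close>

definition hom_set :: "'a pair_pre_digraph \<Rightarrow> 'b pair_pre_digraph \<Rightarrow> ('a \<Rightarrow> 'b) set" where
  "hom_set H T = {f \<in> pverts H \<rightarrow>\<^sub>E pverts T. \<forall>(u, v) \<in> parcs H. (f u, f v) \<in> parcs T}"

definition hom_density :: "'a pair_pre_digraph \<Rightarrow> 'b pair_pre_digraph \<Rightarrow> real" where
  "hom_density H T = real (card (hom_set H T)) / real (card (pverts T)) ^ card (pverts H)"

text \<open>
  For \<open>m \<ge> 3\<close> this is the cycle on \<open>m\<close> vertices; for \<open>m = 2\<close> the two arc conditions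
  coincide and it is the single edge \<open>K\<^sub>2\<close>. It is not loop-free for \<open>m = 1\<close>.
\<close>

definition cycle_graph :: "nat \<Rightarrow> nat pair_pre_digraph" where
  "cycle_graph m =
     \<lparr> pverts = {..<m},
       parcs = {(u, v). u < m \<and> v < m \<and> (v = (u + 1) mod m \<or> u = (v + 1) mod m)} \<rparr>"

lemma pair_graph_cycle_graph:
  assumes "m \<ge> 2"
  shows "pair_graph (cycle_graph m)"
proof -
  have neq: "(u + 1) mod m \<noteq> u" if "u < m" for u
    using that assms by (cases "u + 1 = m") auto
  have "finite (parcs (cycle_graph m))"
    by (rule finite_subset[of _ "{..<m} \<times> {..<m}"]) (auto simp: cycle_graph_def)
  then show ?thesis
    using neq
    by unfold_locales (auto simp: cycle_graph_def symmetric_def arcs_ends_conv intro!: symI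
        dest: neq[symmetric])
qed

lemma cycle_graph_2: "parcs (cycle_graph 2) = {(0, 1), (1, 0)}"
  by (auto simp: cycle_graph_def less_2_cases_iff)

definition even_cycles :: "nat \<Rightarrow> nat pair_pre_digraph list" where
  "even_cycles k = map (\<lambda>i. cycle_graph (2 * i)) [1..<k + 1]"

text \<open>
  \<open>\<real>\<^sup>s\<close> is \<^term>\<open>Euclidean_space s\<close>, whose points are the \<open>x :: nat \<Rightarrow> real\<close> with \<open>x i = 0\<close>
  for \<open>i \<ge> s\<close>; the coordinates are thus numbered \<open>0, \<dots>, s - 1\<close>.
\<close>

definition density_vector :: "'a pair_pre_digraph list \<Rightarrow> 'b pair_pre_digraph \<Rightarrow> nat \<Rightarrow> real" where
  "density_vector Hs T = (\<lambda>i. if i < length Hs then hom_density (Hs ! i) T else 0)"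

text \<open>
  Every finite graph is isomorphic to one with vertices in \<^typ>\<open>nat\<close>. The target graph has to
  have a vertex for the density to be defined.
\<close>

definition density_profile :: "'a pair_pre_digraph list \<Rightarrow> (nat \<Rightarrow> real) set" where
  "density_profile Hs =
     Euclidean_space (length Hs) closure_of
       {density_vector Hs T | T :: nat pair_pre_digraph. pair_graph T \<and> pverts T \<noteq> {}}"

definition log_image :: "nat \<Rightarrow> real \<Rightarrow> (nat \<Rightarrow> real) set \<Rightarrow> (nat \<Rightarrow> real) set" where
  "log_image s b D = (\<lambda>v i. if i < s then log b (v i) else 0) ` {v \<in> D. \<forall>i<s. v i > 0}"

text \<open>
  Limits of families of sets are taken in the sense of Painlev\'e and Kuratowski: the lower and
  the upper limit have to agree.
\<close>

definition lower_limit :: "'a topology \<Rightarrow> ('b \<Rightarrow> 'a set) \<Rightarrow> 'b filter \<Rightarrow> 'a set" where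
  "lower_limit X A F =
     {x \<in> topspace X. \<forall>U. openin X U \<and> x \<in> U \<longrightarrow> (\<forall>\<^sub>F t in F. A t \<inter> U \<noteq> {})}"

definition upper_limit :: "'a topology \<Rightarrow> ('b \<Rightarrow> 'a set) \<Rightarrow> 'b filter \<Rightarrow> 'a set" where
  "upper_limit X A F =
     {x \<in> topspace X. \<forall>U. openin X U \<and> x \<in> U \<longrightarrow> (\<exists>\<^sub>F t in F. A t \<inter> U \<noteq> {})}"

definition set_limit :: "'a topology \<Rightarrow> ('b \<Rightarrow> 'a set) \<Rightarrow> 'a set \<Rightarrow> 'b filter \<Rightarrow> bool" where
  "set_limit X A L F \<longleftrightarrow> lower_limit X A F = L \<and> upper_limit X A F = L"

lemma set_limit_unique: "set_limit X A L F \<Longrightarrow> set_limit X A L' F \<Longrightarrow> L = L'"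
  by (simp add: set_limit_def)

definition is_trop :: "nat \<Rightarrow> (nat \<Rightarrow> real) set \<Rightarrow> (nat \<Rightarrow> real) set \<Rightarrow> bool" where
  "is_trop s D L \<longleftrightarrow> set_limit (Euclidean_space s) (\<lambda>t. log_image s (1 / t) D) L (at_right 0)"

text \<open>Meaningful only if the limit exists, i.e. if \<open>is_trop s D L\<close> holds for some \<open>L\<close>.\<close>

definition trop :: "nat \<Rightarrow> (nat \<Rightarrow> real) set \<Rightarrow> (nat \<Rightarrow> real) set" where
  "trop s D = (THE L. is_trop s D L)"

text \<open>
  The coordinate \<open>y\<^sub>2\<^sub>j\<close>, belonging to the cycle on \<open>2j\<close> vertices, is \<open>y (j - 1)\<close>.
\<close>

definition Q_cone :: "nat \<Rightarrow> (nat \<Rightarrow> real) set" where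
  "Q_cone k =
     {y \<in> topspace (Euclidean_space k).
        (\<forall>i. 1 \<le> i \<and> i \<le> k - 2 \<longrightarrow> y (i - 1) - 2 * y i + y (i + 1) \<ge> 0) \<and>
        2 * real k * y (k - 2) - (2 * real k - 2) * y (k - 1) \<ge> 0 \<and>
        - 2 * real k * y 0 + y (k - 1) \<ge> 0}"

end

theory Submission
  imports Defs "HOL-Number_Theory.Cong" "HOL-Real_Asymp.Real_Asymp"
begin

text \<open>
  The number of homomorphisms from the \<open>2 i\<close>-cycle is the squared Frobenius norm of the \<open>i\<close>-th
  power of the adjacency matrix, so the three kinds of inequalities follow from the Cauchy--Schwarz
  inequality alone: log-convexity, monotonicity of the Schatten norms and Sidorenko's inequality.

  Conversely, tensor products multiply densities, so the tropicalization contains the closed convex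
  cone spanned by the logarithmic density vectors of single graphs. The cone of the theorem is
  simplicial. One of its rays is approximated by an edge with many isolated vertices. The others come
  from the graph on the nonzero residues modulo a prime \<open>P\<close> in which \<open>u\<close> and \<open>v\<close> are adjacent if
  \<open>u * v mod P \<le> x\<close>, where \<open>x\<close> is about the \<open>j\<close>-th root of \<open>P\<close>: closed walks of length \<open>2 i\<close> with
  \<open>i \<le> j\<close> correspond to solutions of \<open>a\<^sub>1 \<cdots> a\<^sub>i = b\<^sub>1 \<cdots> b\<^sub>i\<close> in \<open>{1..x}\<close>, and by
  the divisor bound there are only \<open>x\<close> to the \<open>i + o(1)\<close> of them.
\<close>

section \<open>Limits of families of sets\<close>

lemma lower_limit_subset_upper_limit:
  assumes "F \<noteq> bot"
  shows "lower_limit X A F \<subseteq> upper_limit X A F"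
  using assms unfolding lower_limit_def upper_limit_def by (auto intro!: eventually_frequently)

lemma closedin_lower_limit: "closedin X (lower_limit X A F)"
proof -
  let ?C = "topspace X - lower_limit X A F"
  have "\<exists>V. openin X V \<and> x \<in> V \<and> V \<subseteq> ?C" if "x \<in> ?C" for x
  proof -
    from that obtain V where V: "openin X V" "x \<in> V" "\<not> (\<forall>\<^sub>F t in F. A t \<inter> V \<noteq> {})"
      by (auto simp: lower_limit_def)
    then have "y \<notin> lower_limit X A F" if "y \<in> V" for y
      using that by (auto simp: lower_limit_def)
    with V openin_subset[OF V(1)] show ?thesis by blast
  qed
  then have "openin X ?C" by (subst openin_subopen) blast
  then show ?thesis by (auto simp: closedin_def lower_limit_def)
qed

lemma lower_limitI:
  assumes "limitin X g x F" "\<forall>\<^sub>F t in F. g t \<in> A t"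
  shows "x \<in> lower_limit X A F"
  unfolding lower_limit_def
proof (intro CollectI conjI allI impI)
  show "x \<in> topspace X" using assms(1) by (simp add: limitin_def)
  fix U assume "openin X U \<and> x \<in> U"
  then have "\<forall>\<^sub>F t in F. g t \<in> U" using assms(1) by (simp add: limitin_def)
  with assms(2) show "\<forall>\<^sub>F t in F. A t \<inter> U \<noteq> {}" by eventually_elim blast
qed

lemma lower_limit_Times:
  assumes "x \<in> lower_limit X A F" "y \<in> lower_limit Y B F"
  shows "(x, y) \<in> lower_limit (prod_topology X Y) (\<lambda>t. A t \<times> B t) F"
  unfolding lower_limit_def
proof (intro CollectI conjI allI impI)
  show "(x, y) \<in> topspace (prod_topology X Y)" using assms by (simp add: lower_limit_def)
  fix W assume "openin (prod_topology X Y) W \<and> (x, y) \<in> W"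
  then obtain U V where UV: "openin X U" "openin Y V" "x \<in> U" "y \<in> V" "U \<times> V \<subseteq> W"
    unfolding openin_prod_topology_alt by meson
  then have "\<forall>\<^sub>F t in F. A t \<inter> U \<noteq> {}" "\<forall>\<^sub>F t in F. B t \<inter> V \<noteq> {}"
    using assms by (auto simp: lower_limit_def)
  then show "\<forall>\<^sub>F t in F. A t \<times> B t \<inter> W \<noteq> {}"
    by eventually_elim (use UV(5) in blast)
qed

lemma lower_limit_continuous_map:
  assumes "continuous_map X Y f" "x \<in> lower_limit X A F" "\<forall>\<^sub>F t in F. f ` A t \<subseteq> B t"
  shows "f x \<in> lower_limit Y B F"
  unfolding lower_limit_def
proof (intro CollectI conjI allI impI)
  have x: "x \<in> topspace X" using assms(2) by (simp add: lower_limit_def)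
  then show "f x \<in> topspace Y" using continuous_map_image_subset_topspace[OF assms(1)] by blast
  fix V assume V: "openin Y V \<and> f x \<in> V"
  let ?U = "{z \<in> topspace X. f z \<in> V}"
  have "openin X ?U" using openin_continuous_map_preimage[OF assms(1)] V by blast
  then have "\<forall>\<^sub>F t in F. A t \<inter> ?U \<noteq> {}" using assms(2) x V by (simp add: lower_limit_def)
  with assms(3) show "\<forall>\<^sub>F t in F. B t \<inter> V \<noteq> {}" by eventually_elim blast
qed

lemma upper_limit_subset_closed:
  assumes "closedin X Q" "\<forall>\<^sub>F t in F. A t \<subseteq> Q"
  shows "upper_limit X A F \<subseteq> Q"
proof
  fix x assume x: "x \<in> upper_limit X A F"
  have "\<not> (\<exists>\<^sub>F t in F. A t \<inter> (topspace X - Q) \<noteq> {})"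
    unfolding not_frequently using assms(2) by eventually_elim blast
  moreover have "openin X (topspace X - Q)" using assms(1) by (simp add: closedin_def)
  ultimately show "x \<in> Q" using x unfolding upper_limit_def by blast
qed

section \<open>Tropicalization of sets closed under multiplication\<close>

abbreviation zero_extend :: "nat \<Rightarrow> (nat \<Rightarrow> real) \<Rightarrow> nat \<Rightarrow> real" where
  "zero_extend s f \<equiv> (\<lambda>i. if i < s then f i else 0)"

lemma continuous_map_Euclidean_space_coordinate:
  "continuous_map (Euclidean_space s) euclideanreal (\<lambda>v. v i)"
  unfolding Euclidean_space_def
  by (intro continuous_map_from_subtopology) (metis UNIV_I continuous_map_product_coordinates)

lemma continuous_map_Euclidean_space_mult:
  assumes "continuous_map X (Euclidean_space s) f" "continuous_map X (Euclidean_space s) g"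
  shows "continuous_map X (Euclidean_space s) (\<lambda>x i. f x i * g x i)"
  using assms unfolding Euclidean_space_def continuous_map_in_subtopology
  by (auto simp: continuous_map_componentwise_UNIV Pi_iff continuous_map_real_mult)

lemma limitin_Euclidean_space_zero_extend:
  "limitin (Euclidean_space s) (\<lambda>t. zero_extend s (g t)) (zero_extend s y) F \<longleftrightarrow>
     (\<forall>i<s. ((\<lambda>t. g t i) \<longlongrightarrow> y i) F)"
proof -
  have "((\<lambda>t. if i < s then g t i else 0) \<longlongrightarrow> (if i < s then y i else 0)) F \<longleftrightarrow>
      (i < s \<longrightarrow> ((\<lambda>t. g t i) \<longlongrightarrow> y i) F)" for i
    by simp
  then show ?thesis
    unfolding Euclidean_space_def by (simp add: limitin_subtopology limitin_componentwise)
qed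

lemma zero_extend_eq:
  assumes "y \<in> topspace (Euclidean_space s)" "\<And>i. i < s \<Longrightarrow> f i = y i"
  shows "zero_extend s f = y"
  using assms by (auto simp: topspace_Euclidean_space fun_eq_iff)

lemma openin_Euclidean_space_positive:
  "openin (Euclidean_space s) {v \<in> topspace (Euclidean_space s). \<forall>i<s. v i > 0}"
proof -
  let ?E = "Euclidean_space s"
  have "openin ?E {v \<in> topspace ?E. v i \<in> {0<..}}" for i
    by (rule openin_continuous_map_preimage[OF continuous_map_Euclidean_space_coordinate]) simp
  then have "openin ?E (topspace ?E \<inter> (\<Inter>i\<in>{..<s}. {v \<in> topspace ?E. v i \<in> {0<..}}))"
    by (intro openin_Int_Inter) auto
  also have "topspace ?E \<inter> (\<Inter>i\<in>{..<s}. {v \<in> topspace ?E. v i \<in> {0<..}}) =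
      {v \<in> topspace ?E. \<forall>i<s. v i > 0}"
    by auto
  finally show ?thesis .
qed

lemma continuous_map_log:
  assumes "continuous_map X euclideanreal f" "\<And>v. v \<in> topspace X \<Longrightarrow> f v > 0"
  shows "continuous_map X euclideanreal (\<lambda>v. log b (f v))"
proof -
  have "continuous_map X (top_of_set {0<..}) f"
    using assms by (auto simp: continuous_map_in_subtopology)
  moreover have "continuous_on {0<..} (log b)"
    unfolding log_def divide_inverse by (intro continuous_intros) auto
  ultimately show ?thesis
    using continuous_map_compose[of X _ f euclideanreal "log b"]
    by (simp add: o_def continuous_map_iff_continuous)
qed

lemma log_image_closure_of:
  "log_image s b (Euclidean_space s closure_of S) \<subseteq> Euclidean_space s closure_of (log_image s b S)"
proof -
  let ?E = "Euclidean_space s"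
  define P where "P = {v \<in> topspace ?E. \<forall>i<s. v i > 0}"
  define \<phi> where "\<phi> v = zero_extend s (\<lambda>i. log b (v i))" for v
  have "openin ?E P" unfolding P_def by (rule openin_Euclidean_space_positive)
  then have P_closure: "P \<inter> ?E closure_of S \<subseteq> subtopology ?E P closure_of (P \<inter> S)"
    using openin_Int_closure_of_subset[of ?E P S] by (simp add: closure_of_subtopology)
  have "continuous_map (subtopology ?E P) euclideanreal (\<lambda>v. log b (v i))" if "i < s" for i
    using that
    by (intro continuous_map_log continuous_map_from_subtopology continuous_map_Euclidean_space_coordinate)
      (auto simp: P_def)
  then have \<phi>_continuous: "continuous_map (subtopology ?E P) ?E \<phi>"
    unfolding \<phi>_def continuous_map_componentwise_Euclidean_space by blast
  have "log_image s b (?E closure_of S) \<subseteq> \<phi> ` (P \<inter> ?E closure_of S)"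
    using closure_of_subset_topspace[of ?E S] by (auto simp: log_image_def \<phi>_def P_def)
  also have "\<dots> \<subseteq> \<phi> ` (subtopology ?E P closure_of (P \<inter> S))"
    using P_closure by blast
  also have "\<dots> \<subseteq> ?E closure_of (\<phi> ` (P \<inter> S))"
    using \<phi>_continuous by (rule continuous_map_image_closure_subset)
  also have "\<dots> \<subseteq> ?E closure_of (log_image s b S)"
    by (intro closure_of_mono) (auto simp: log_image_def \<phi>_def P_def)
  finally show ?thesis .
qed

definition mult_closed :: "(nat \<Rightarrow> real) set \<Rightarrow> bool" where
  "mult_closed D \<longleftrightarrow> (\<forall>u\<in>D. \<forall>v\<in>D. (\<lambda>i. u i * v i) \<in> D)"

lemma mult_closed_power:
  assumes "mult_closed D" "v \<in> D"
  shows "(\<lambda>i. v i ^ Suc m) \<in> D"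
proof (induction m)
  case (Suc m)
  then show ?case
    using assms(1)[unfolded mult_closed_def, rule_format, OF assms(2)] by simp
qed (use assms(2) in simp)

lemma mult_closed_closure_of:
  assumes "mult_closed S"
  shows "mult_closed (Euclidean_space s closure_of S)"
proof -
  let ?E = "Euclidean_space s"
  let ?mult = "\<lambda>p i. fst p i * snd p i :: real"
  have "continuous_map (prod_topology ?E ?E) ?E ?mult"
    by (intro continuous_map_Euclidean_space_mult continuous_map_fst continuous_map_snd)
  then have "?mult ` (prod_topology ?E ?E closure_of (S \<times> S)) \<subseteq> ?E closure_of (?mult ` (S \<times> S))"
    by (rule continuous_map_image_closure_subset)
  also have "\<dots> \<subseteq> ?E closure_of S"
    using assms by (intro closure_of_mono) (auto simp: mult_closed_def)
  finally show ?thesis by (force simp: mult_closed_def closure_of_Times)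
qed

definition lower_trop :: "nat \<Rightarrow> (nat \<Rightarrow> real) set \<Rightarrow> (nat \<Rightarrow> real) set" where
  "lower_trop s D = lower_limit (Euclidean_space s) (\<lambda>t. log_image s (1 / t) D) (at_right 0)"

lemma lower_trop_add:
  assumes "mult_closed D" "x \<in> lower_trop s D" "y \<in> lower_trop s D"
  shows "(\<lambda>i. x i + y i) \<in> lower_trop s D"
proof -
  let ?E = "Euclidean_space s"
  let ?add = "\<lambda>p i. fst p i + snd p i :: real"
  have "?add ` (log_image s b D \<times> log_image s b D) \<subseteq> log_image s b D" for b
  proof (rule image_subsetI, elim SigmaE)
    fix p x y assume p_eq: "p = (x, y)" and "x \<in> log_image s b D" "y \<in> log_image s b D"
    then obtain u v where uv: "u \<in> D" "v \<in> D" "\<forall>i<s. u i > 0" "\<forall>i<s. v i > 0"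
      and xy: "x = zero_extend s (\<lambda>i. log b (u i))" "y = zero_extend s (\<lambda>i. log b (v i))"
      unfolding log_image_def by blast
    have "?add p = zero_extend s (\<lambda>i. log b (u i * v i))"
      using uv(3,4) by (auto simp: p_eq xy fun_eq_iff log_mult_pos)
    moreover have "(\<lambda>i. u i * v i) \<in> D" using assms(1) uv(1,2) by (simp add: mult_closed_def)
    ultimately show "?add p \<in> log_image s b D"
      unfolding log_image_def using uv(3,4) by (intro image_eqI[of _ _ "\<lambda>i. u i * v i"]) auto
  qed
  then have eventually_add: "\<forall>\<^sub>F t in at_right 0.
      ?add ` (log_image s (1 / t) D \<times> log_image s (1 / t) D) \<subseteq> log_image s (1 / t) D"
    by (intro always_eventually allI)
  have "continuous_map (prod_topology ?E ?E) ?E ?add"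
    by (intro continuous_map_Euclidean_space_add continuous_map_fst continuous_map_snd)
  then have "?add (x, y) \<in> lower_trop s D"
    using lower_limit_Times[OF assms(2,3)[unfolded lower_trop_def]] eventually_add
    unfolding lower_trop_def by (rule lower_limit_continuous_map)
  then show ?thesis by simp
qed

lemma lower_trop_sum:
  assumes "mult_closed D" "finite J" "J \<noteq> {}" "\<And>j. j \<in> J \<Longrightarrow> f j \<in> lower_trop s D"
  shows "(\<lambda>i. \<Sum>j\<in>J. f j i) \<in> lower_trop s D"
  using assms(2-) by (induction J rule: finite_ne_induct) (auto intro: lower_trop_add[OF assms(1)])

lemma floor_ratio_tendsto:
  assumes "c \<ge> 0"
  shows "((\<lambda>L::real. real (Suc (nat \<lfloor>c * L\<rfloor>)) / L) \<longlongrightarrow> c) at_top"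
proof (rule tendsto_sandwich)
  have positive: "\<forall>\<^sub>F L::real in at_top. L > 0" by (rule eventually_gt_at_top)
  then show "\<forall>\<^sub>F L in at_top. c \<le> real (Suc (nat \<lfloor>c * L\<rfloor>)) / L"
  proof eventually_elim
    case (elim L)
    have "c * L \<le> real (Suc (nat \<lfloor>c * L\<rfloor>))" by linarith
    then show ?case using elim by (simp add: field_simps)
  qed
  show "\<forall>\<^sub>F L in at_top. real (Suc (nat \<lfloor>c * L\<rfloor>)) / L \<le> c + 1 / L"
    using positive
  proof eventually_elim
    case (elim L)
    have "c * L \<ge> 0" using assms elim by simp
    then have "real (Suc (nat \<lfloor>c * L\<rfloor>)) \<le> c * L + 1" by linarith
    then show ?case using elim by (simp add: field_simps)
  qed
  show "((\<lambda>L::real. c + 1 / L) \<longlongrightarrow> c) at_top" by real_asymp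
qed simp

text \<open>The point is approached by the powers of \<open>v\<close> with exponents \<open>m\<close> such that \<open>m / ln (1 / t)\<close>
  tends to \<open>c\<close>.\<close>

lemma scaled_ln_in_lower_trop:
  assumes "mult_closed D" "v \<in> D" "\<And>i. i < s \<Longrightarrow> v i > 0" "c \<ge> 0"
  shows "zero_extend s (\<lambda>i. c * ln (v i)) \<in> lower_trop s D"
  unfolding lower_trop_def
proof (rule lower_limitI)
  define m where "m t = nat \<lfloor>c * ln (1 / t)\<rfloor>" for t :: real
  define g where "g t i = real (Suc (m t)) / ln (1 / t) * ln (v i)" for t i
  have "filterlim (\<lambda>t::real. ln (1 / t)) at_top (at_right 0)" by real_asymp
  from filterlim_compose[OF floor_ratio_tendsto[OF assms(4)] this]
  have "((\<lambda>t. g t i) \<longlongrightarrow> c * ln (v i)) (at_right 0)" for i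
    unfolding g_def m_def by (rule tendsto_mult_right)
  then show "limitin (Euclidean_space s) (\<lambda>t. zero_extend s (g t))
      (zero_extend s (\<lambda>i. c * ln (v i))) (at_right 0)"
    by (simp add: limitin_Euclidean_space_zero_extend)
  have "zero_extend s (g t) \<in> log_image s (1 / t) D" for t
    unfolding log_image_def
  proof (rule image_eqI)
    show "(\<lambda>i. v i ^ Suc (m t)) \<in> {v \<in> D. \<forall>i<s. v i > 0}"
      using mult_closed_power[OF assms(1,2)] assms(3) by (simp del: power_Suc)
    show "zero_extend s (g t) = zero_extend s (\<lambda>i. log (1 / t) (v i ^ Suc (m t)))"
      using assms(3) by (simp add: fun_eq_iff g_def log_def ln_realpow del: power_Suc)
  qed
  then show "\<forall>\<^sub>F t in at_right 0. zero_extend s (g t) \<in> log_image s (1 / t) D"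
    by (simp add: always_eventually)
qed

lemma lower_trop_limit_scaled_ln:
  fixes v :: "nat \<Rightarrow> nat \<Rightarrow> real" and c :: "nat \<Rightarrow> real"
  assumes "mult_closed D" "\<And>n. v n \<in> D" "\<And>n i. i < s \<Longrightarrow> v n i > 0" "\<And>n. c n \<ge> 0"
    and "\<And>i. i < s \<Longrightarrow> (\<lambda>n. c n * ln (v n i)) \<longlonglongrightarrow> y i"
  shows "zero_extend s y \<in> lower_trop s D"
proof (rule limitin_closedin)
  show "limitin (Euclidean_space s) (\<lambda>n. zero_extend s (\<lambda>i. c n * ln (v n i)))
      (zero_extend s y) sequentially"
    using assms(5) by (simp add: limitin_Euclidean_space_zero_extend)
  show "closedin (Euclidean_space s) (lower_trop s D)"
    unfolding lower_trop_def by (rule closedin_lower_limit)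
  show "\<forall>\<^sub>F n in sequentially. zero_extend s (\<lambda>i. c n * ln (v n i)) \<in> lower_trop s D"
    using assms(1-4) by (intro always_eventually allI scaled_ln_in_lower_trop)
qed simp

lemma is_tropI:
  assumes "closedin (Euclidean_space s) Q" "\<And>b. b > 1 \<Longrightarrow> log_image s b D \<subseteq> Q" "Q \<subseteq> lower_trop s D"
  shows "is_trop s D Q"
proof -
  let ?A = "\<lambda>t. log_image s (1 / t) D"
  have "\<forall>\<^sub>F t::real in at_right 0. t < 1"
    using eventually_at_right_less[of "0::real"]
    by (auto simp: eventually_at_right_field intro: exI[of _ 1])
  with eventually_at_right_less have "\<forall>\<^sub>F t in at_right 0. ?A t \<subseteq> Q"
    by eventually_elim (simp add: assms(2))
  with assms(1) have "upper_limit (Euclidean_space s) ?A (at_right 0) \<subseteq> Q"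
    by (rule upper_limit_subset_closed)
  then show ?thesis
    using assms(3) lower_limit_subset_upper_limit[of "at_right 0" "Euclidean_space s" ?A]
    unfolding is_trop_def set_limit_def lower_trop_def by auto
qed

lemma trop_eqI: "is_trop s D L \<Longrightarrow> trop s D = L"
  unfolding trop_def is_trop_def by (rule the_equality, assumption) (rule set_limit_unique)

section \<open>Density profiles are closed under multiplication\<close>

lemma pair_graph_iff:
  "pair_graph T \<longleftrightarrow> finite (pverts T) \<and> parcs T \<subseteq> pverts T \<times> pverts T \<and>
     sym (parcs T) \<and> irrefl (parcs T)" (is "?L \<longleftrightarrow> ?R")
proof
  assume ?L
  then interpret pair_graph T .
  show ?R
    using pair_finite_verts in_arcsD1 in_arcsD2 pair_sym_arcs pair_no_loops
    by (fastforce simp: symmetric_def irrefl_def)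
next
  assume R: ?R
  then have "finite (parcs T)"
    by (metis finite_SigmaI finite_subset)
  with R show ?L
    by unfold_locales (auto simp: symmetric_def irrefl_def)
qed

definition relabel_graph :: "('b \<Rightarrow> 'c) \<Rightarrow> 'b pair_pre_digraph \<Rightarrow> 'c pair_pre_digraph" where
  "relabel_graph \<phi> T = \<lparr> pverts = \<phi> ` pverts T, parcs = map_prod \<phi> \<phi> ` parcs T \<rparr>"

lemma pair_graph_relabel_graph:
  assumes "pair_graph T" "inj_on \<phi> (pverts T)"
  shows "pair_graph (relabel_graph \<phi> T)"
proof -
  have arcs: "parcs T \<subseteq> pverts T \<times> pverts T" "sym (parcs T)" "irrefl (parcs T)"
    using assms(1) by (auto simp: pair_graph_iff)
  have "irrefl (map_prod \<phi> \<phi> ` parcs T)"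
    using arcs(1,3) inj_onD[OF assms(2)] by (fastforce simp: irrefl_def)
  moreover have "sym (map_prod \<phi> \<phi> ` parcs T)"
    using symD[OF arcs(2)] by (fastforce simp: sym_def)
  ultimately show ?thesis
    using assms(1) by (auto simp: pair_graph_iff relabel_graph_def)
qed

lemma bij_betw_hom_set_relabel_graph:
  assumes "pair_wf_digraph H" "pair_wf_digraph T" "inj_on \<phi> (pverts T)"
  shows "bij_betw (\<lambda>f. \<lambda>u\<in>pverts H. \<phi> (f u)) (hom_set H T) (hom_set H (relabel_graph \<phi> T))"
proof (rule bij_betw_byWitness[where f' = "\<lambda>g. \<lambda>u\<in>pverts H. the_inv_into (pverts T) \<phi> (g u)"])
  let ?inv = "the_inv_into (pverts T) \<phi>"
  have arcs: "u \<in> pverts H" "v \<in> pverts H" if "(u, v) \<in> parcs H" for u v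
    using that assms(1) by (auto simp: pair_wf_digraph_def)
  have arcs_T: "u \<in> pverts T" "v \<in> pverts T" if "(u, v) \<in> parcs T" for u v
    using that assms(2) by (auto simp: pair_wf_digraph_def)
  have inv: "?inv (\<phi> x) = x" if "x \<in> pverts T" for x
    using assms(3) that by (rule the_inv_into_f_f)
  show "\<forall>f\<in>hom_set H T. (\<lambda>u\<in>pverts H. ?inv ((\<lambda>u\<in>pverts H. \<phi> (f u)) u)) = f"
    using inv by (auto simp: hom_set_def PiE_iff extensional_def fun_eq_iff)
  have "\<phi> (?inv y) = y" if "y \<in> \<phi> ` pverts T" for y
    using assms(3) that by (rule f_the_inv_into_f)
  then show "\<forall>g\<in>hom_set H (relabel_graph \<phi> T). (\<lambda>u\<in>pverts H. \<phi> ((\<lambda>u\<in>pverts H. ?inv (g u)) u)) = g"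
    by (auto simp: hom_set_def relabel_graph_def PiE_iff extensional_def fun_eq_iff)
  show "(\<lambda>f. \<lambda>u\<in>pverts H. \<phi> (f u)) ` hom_set H T \<subseteq> hom_set H (relabel_graph \<phi> T)"
    using arcs by (fastforce simp: hom_set_def relabel_graph_def PiE_iff)
  show "(\<lambda>g. \<lambda>u\<in>pverts H. ?inv (g u)) ` hom_set H (relabel_graph \<phi> T) \<subseteq> hom_set H T"
  proof (rule image_subsetI)
    fix g assume g: "g \<in> hom_set H (relabel_graph \<phi> T)"
    then have "?inv (g u) \<in> pverts T" if "u \<in> pverts H" for u
      using that inv by (fastforce simp: hom_set_def relabel_graph_def PiE_iff)
    moreover have "(?inv (g u), ?inv (g v)) \<in> parcs T" if "(u, v) \<in> parcs H" for u v
    proof -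
      obtain x y where "(x, y) \<in> parcs T" "g u = \<phi> x" "g v = \<phi> y"
        using g \<open>(u, v) \<in> parcs H\<close> by (auto simp: hom_set_def relabel_graph_def)
      then show ?thesis using arcs_T inv by simp
    qed
    ultimately show "(\<lambda>u\<in>pverts H. ?inv (g u)) \<in> hom_set H T"
      using arcs by (auto simp: hom_set_def)
  qed
qed

lemma hom_density_relabel_graph:
  assumes "pair_wf_digraph H" "pair_wf_digraph T" "inj_on \<phi> (pverts T)"
  shows "hom_density H (relabel_graph \<phi> T) = hom_density H T"
proof -
  have "card (pverts (relabel_graph \<phi> T)) = card (pverts T)"
    using assms(3) by (simp add: relabel_graph_def card_image)
  then show ?thesis
    using bij_betw_same_card[OF bij_betw_hom_set_relabel_graph[OF assms]]
    by (simp add: hom_density_def)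
qed

definition tensor_graph ::
    "'b pair_pre_digraph \<Rightarrow> 'c pair_pre_digraph \<Rightarrow> ('b \<times> 'c) pair_pre_digraph" where
  "tensor_graph T T' =
     \<lparr> pverts = pverts T \<times> pverts T',
       parcs = {((u, u'), (v, v')) | u u' v v'. (u, v) \<in> parcs T \<and> (u', v') \<in> parcs T'} \<rparr>"

lemma pair_graph_tensor_graph:
  assumes "pair_graph T" "pair_graph T'"
  shows "pair_graph (tensor_graph T T')"
  using assms unfolding pair_graph_iff tensor_graph_def sym_def irrefl_def by (auto 0 3)

lemma bij_betw_hom_set_tensor_graph:
  assumes "pair_wf_digraph H"
  shows "bij_betw (\<lambda>f. (\<lambda>u\<in>pverts H. fst (f u), \<lambda>u\<in>pverts H. snd (f u)))
    (hom_set H (tensor_graph T T')) (hom_set H T \<times> hom_set H T')" (is "bij_betw ?split ?HTT ?HT")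
proof (rule bij_betw_byWitness[where f' = "\<lambda>(g, g'). \<lambda>u\<in>pverts H. (g u, g' u)"])
  have arcs: "u \<in> pverts H" "v \<in> pverts H" if "(u, v) \<in> parcs H" for u v
    using that assms by (auto simp: pair_wf_digraph_def)
  show "\<forall>f\<in>?HTT. (case ?split f of (g, g') \<Rightarrow> \<lambda>u\<in>pverts H. (g u, g' u)) = f"
    by (auto simp: hom_set_def PiE_iff extensional_def fun_eq_iff)
  show "\<forall>p\<in>?HT. ?split (case p of (g, g') \<Rightarrow> \<lambda>u\<in>pverts H. (g u, g' u)) = p"
    by (auto simp: hom_set_def PiE_iff extensional_def fun_eq_iff)
  show "?split ` ?HTT \<subseteq> ?HT"
    using arcs by (fastforce simp: hom_set_def tensor_graph_def PiE_iff)
  show "(\<lambda>(g, g'). \<lambda>u\<in>pverts H. (g u, g' u)) ` ?HT \<subseteq> ?HTT"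
    using arcs by (fastforce simp: hom_set_def tensor_graph_def PiE_iff)
qed

lemma hom_density_tensor_graph:
  assumes "pair_wf_digraph H"
  shows "hom_density H (tensor_graph T T') = hom_density H T * hom_density H T'"
proof -
  have "card (hom_set H (tensor_graph T T')) = card (hom_set H T) * card (hom_set H T')"
    using bij_betw_same_card[OF bij_betw_hom_set_tensor_graph[OF assms]]
    by (simp add: card_cartesian_product)
  moreover have "card (pverts (tensor_graph T T')) = card (pverts T) * card (pverts T')"
    by (simp add: tensor_graph_def card_cartesian_product)
  ultimately show ?thesis by (simp add: hom_density_def power_mult_distrib)
qed

definition graph_density_vectors :: "'a pair_pre_digraph list \<Rightarrow> (nat \<Rightarrow> real) set" where
  "graph_density_vectors Hs =
     {density_vector Hs T | T :: nat pair_pre_digraph. pair_graph T \<and> pverts T \<noteq> {}}"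

lemma density_profile_eq_closure:
  "density_profile Hs = Euclidean_space (length Hs) closure_of graph_density_vectors Hs"
  by (simp add: density_profile_def graph_density_vectors_def)

lemma density_vector_in_graph_density_vectors:
  fixes T :: "'b pair_pre_digraph"
  assumes "\<And>H. H \<in> set Hs \<Longrightarrow> pair_wf_digraph H" "pair_graph T" "pverts T \<noteq> {}"
  shows "density_vector Hs T \<in> graph_density_vectors Hs"
proof -
  interpret pair_graph T by fact
  obtain \<phi> :: "'b \<Rightarrow> nat" where \<phi>: "inj_on \<phi> (pverts T)"
    using finite_imp_inj_to_nat_seg[OF pair_finite_verts] by blast
  have "density_vector Hs T = density_vector Hs (relabel_graph \<phi> T)"
    using assms(1)
    by (auto simp: density_vector_def hom_density_relabel_graph[OF _ _ \<phi>] pair_wf_digraph_axioms)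
  moreover have "pverts (relabel_graph \<phi> T) \<noteq> {}"
    using assms(3) by (simp add: relabel_graph_def)
  ultimately show ?thesis
    unfolding graph_density_vectors_def using pair_graph_relabel_graph[OF assms(2) \<phi>] by blast
qed

lemma graph_density_vectors_subset_profile: "graph_density_vectors Hs \<subseteq> density_profile Hs"
  unfolding density_profile_eq_closure
  by (rule closure_of_subset)
    (auto simp: graph_density_vectors_def density_vector_def topspace_Euclidean_space)

lemma mult_closed_graph_density_vectors:
  assumes "\<And>H. H \<in> set Hs \<Longrightarrow> pair_wf_digraph H"
  shows "mult_closed (graph_density_vectors Hs)"
  unfolding mult_closed_def
proof (intro ballI)
  fix u v assume "u \<in> graph_density_vectors Hs" "v \<in> graph_density_vectors Hs"
  then obtain T T' :: "nat pair_pre_digraph"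
    where T: "pair_graph T" "pverts T \<noteq> {}" "u = density_vector Hs T"
      and T': "pair_graph T'" "pverts T' \<noteq> {}" "v = density_vector Hs T'"
    unfolding graph_density_vectors_def by blast
  have "(\<lambda>i. u i * v i) = density_vector Hs (tensor_graph T T')"
    using assms by (auto simp: T(3) T'(3) density_vector_def hom_density_tensor_graph)
  moreover have "pverts (tensor_graph T T') \<noteq> {}"
    using T(2) T'(2) by (simp add: tensor_graph_def)
  ultimately show "(\<lambda>i. u i * v i) \<in> graph_density_vectors Hs"
    using density_vector_in_graph_density_vectors[OF assms pair_graph_tensor_graph[OF T(1) T'(1)]]
    by simp
qed

lemma mult_closed_density_profile:
  assumes "\<And>H. H \<in> set Hs \<Longrightarrow> pair_wf_digraph H"
  shows "mult_closed (density_profile Hs)"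
  unfolding density_profile_eq_closure
  by (intro mult_closed_closure_of mult_closed_graph_density_vectors assms)

section \<open>Walks\<close>

primrec walk_count :: "'a pair_pre_digraph \<Rightarrow> nat \<Rightarrow> 'a \<Rightarrow> 'a \<Rightarrow> real" where
  "walk_count T 0 u v = of_bool (u = v)"
| "walk_count T (Suc l) u v = (\<Sum>x\<in>pverts T. walk_count T l u x * of_bool ((x, v) \<in> parcs T))"

lemma walk_count_add:
  assumes "finite (pverts T)" "v \<in> pverts T"
  shows "walk_count T (a + b) u v = (\<Sum>x\<in>pverts T. walk_count T a u x * walk_count T b x v)"
  using assms(2)
proof (induction b arbitrary: v)
  case 0
  then show ?case using assms(1) by (simp add: if_distrib of_bool_def cong: if_cong)
next
  case (Suc b)
  have "walk_count T (a + Suc b) u v =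
      (\<Sum>y\<in>pverts T. \<Sum>x\<in>pverts T. walk_count T a u x * walk_count T b x y * of_bool ((y, v) \<in> parcs T))"
    by (simp add: Suc.IH sum_distrib_right)
  also have "\<dots> =
      (\<Sum>x\<in>pverts T. \<Sum>y\<in>pverts T. walk_count T a u x * walk_count T b x y * of_bool ((y, v) \<in> parcs T))"
    by (rule sum.swap)
  also have "\<dots> = (\<Sum>x\<in>pverts T. walk_count T a u x * walk_count T (Suc b) x v)"
    by (simp add: sum_distrib_left mult.assoc)
  finally show ?case .
qed

lemma walk_count_1:
  assumes "finite (pverts T)" "u \<in> pverts T"
  shows "walk_count T 1 u v = of_bool ((u, v) \<in> parcs T)"
proof -
  have "walk_count T 1 u v = (\<Sum>x\<in>pverts T. if x = u then of_bool ((x, v) \<in> parcs T) else 0)"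
    by (auto intro!: sum.cong)
  then show ?thesis using assms by simp
qed

lemma walk_count_sym:
  assumes "pair_graph T" "u \<in> pverts T" "v \<in> pverts T"
  shows "walk_count T l u v = walk_count T l v u"
  using assms(2,3)
proof (induction l arbitrary: u v)
  case (Suc l)
  have fin: "finite (pverts T)" and sym: "sym (parcs T)"
    using assms(1) by (auto simp: pair_graph_iff)
  have "walk_count T (Suc l) u v = (\<Sum>x\<in>pverts T. walk_count T l u x * of_bool ((x, v) \<in> parcs T))"
    by simp
  also have "\<dots> = (\<Sum>x\<in>pverts T. walk_count T 1 v x * walk_count T l x u)"
  proof (rule sum.cong)
    fix x assume "x \<in> pverts T"
    then show "walk_count T l u x * of_bool ((x, v) \<in> parcs T) =
        walk_count T 1 v x * walk_count T l x u"
      using walk_count_1[OF fin Suc.prems(2), of x] Suc.IH[OF Suc.prems(1), of x] sym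
      by (auto dest: symD)
  qed simp
  also have "\<dots> = walk_count T (1 + l) v u"
    using fin Suc.prems(1) by (rule walk_count_add[symmetric])
  finally show ?case by simp
qed auto

definition walk_moment :: "'a pair_pre_digraph \<Rightarrow> nat \<Rightarrow> real" where
  "walk_moment T i = (\<Sum>u\<in>pverts T. \<Sum>v\<in>pverts T. (walk_count T i u v)\<^sup>2)"

lemma walk_moment_nonneg: "walk_moment T i \<ge> 0"
  by (auto simp: walk_moment_def intro!: sum_nonneg)

lemma walk_moment_add_eq:
  assumes "pair_graph T" "a + b = 2 * i"
  shows "walk_moment T i = (\<Sum>u\<in>pverts T. \<Sum>v\<in>pverts T. walk_count T a u v * walk_count T b u v)"
proof -
  have trace: "(\<Sum>v\<in>pverts T. walk_count T c u v * walk_count T d u v) = walk_count T (c + d) u u"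
    if "u \<in> pverts T" for c d u
  proof -
    have "walk_count T (c + d) u u = (\<Sum>v\<in>pverts T. walk_count T c u v * walk_count T d v u)"
      using assms(1) that by (intro walk_count_add) (auto simp: pair_graph_iff)
    also have "\<dots> = (\<Sum>v\<in>pverts T. walk_count T c u v * walk_count T d u v)"
      using walk_count_sym[OF assms(1) that] by (intro sum.cong) auto
    finally show ?thesis by simp
  qed
  show ?thesis
    unfolding walk_moment_def power2_eq_square
    by (rule sum.cong) (simp_all add: trace assms(2) flip: mult_2)
qed

lemma walk_moment_eq_trace:
  assumes "pair_graph T"
  shows "walk_moment T i = (\<Sum>u\<in>pverts T. walk_count T (2 * i) u u)"
proof -
  have "walk_count T 0 u v * walk_count T (2 * i) u v =
      (if v = u then walk_count T (2 * i) u u else 0)" for u v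
    by simp
  then show ?thesis
    using walk_moment_add_eq[OF assms, of 0 "2 * i" i] assms
    by (simp add: pair_graph_iff del: walk_count.simps)
qed

lemma walk_moment_0:
  assumes "finite (pverts T)"
  shows "walk_moment T 0 = real (card (pverts T))"
proof -
  have "(walk_count T 0 u v)\<^sup>2 = (if v = u then 1 else 0)" for u v
    by simp
  then show ?thesis using assms by (simp add: walk_moment_def del: walk_count.simps)
qed

definition walk_total :: "'a pair_pre_digraph \<Rightarrow> nat \<Rightarrow> real" where
  "walk_total T l = (\<Sum>u\<in>pverts T. \<Sum>v\<in>pverts T. walk_count T l u v)"

lemma walk_moment_1:
  assumes "finite (pverts T)"
  shows "walk_moment T 1 = walk_total T 1"
  unfolding walk_moment_def walk_total_def using walk_count_1[OF assms] by (intro sum.cong) auto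

lemma walk_moment_1_eq_card_parcs:
  assumes "pair_graph T"
  shows "walk_moment T 1 = real (card (parcs T))"
proof -
  have fin: "finite (pverts T)" and sub: "parcs T \<subseteq> pverts T \<times> pverts T"
    using assms by (auto simp: pair_graph_iff)
  have "walk_moment T 1 = (\<Sum>u\<in>pverts T. \<Sum>v\<in>pverts T. of_bool ((u, v) \<in> parcs T))"
    unfolding walk_moment_1[OF fin] walk_total_def using walk_count_1[OF fin]
    by (intro sum.cong) auto
  also have "\<dots> = (\<Sum>e\<in>pverts T \<times> pverts T. of_bool (e \<in> parcs T))"
    by (simp add: sum.cartesian_product case_prod_beta)
  also have "\<dots> = (\<Sum>e\<in>parcs T. 1)"
    using fin sub by (intro sum.mono_neutral_cong_right) auto
  finally show ?thesis by simp
qed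

section \<open>Homomorphisms from cycles\<close>

definition walk_set :: "'a pair_pre_digraph \<Rightarrow> nat \<Rightarrow> 'a \<Rightarrow> 'a \<Rightarrow> (nat \<Rightarrow> 'a) set" where
  "walk_set T l u v =
     {f \<in> {..l} \<rightarrow>\<^sub>E pverts T. f 0 = u \<and> f l = v \<and> (\<forall>i<l. (f i, f (Suc i)) \<in> parcs T)}"

lemma finite_walk_set: "finite (pverts T) \<Longrightarrow> finite (walk_set T l u v)"
  unfolding walk_set_def by (rule finite_subset[of _ "{..l} \<rightarrow>\<^sub>E pverts T"]) (auto intro: finite_PiE)

lemma walk_set_Suc:
  assumes "v \<in> pverts T"
  shows "walk_set T (Suc l) u v =
    (\<Union>x\<in>{x \<in> pverts T. (x, v) \<in> parcs T}. (\<lambda>f. f(Suc l := v)) ` walk_set T l u x)" (is "?A = ?B")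
proof (intro set_eqI iffI)
  fix f assume f: "f \<in> ?A"
  let ?g = "restrict f {..l}"
  have "?g \<in> walk_set T l u (f l)" "f l \<in> {x \<in> pverts T. (x, v) \<in> parcs T}"
    using f by (auto simp: walk_set_def PiE_iff)
  moreover have "f = ?g(Suc l := v)"
    using f by (auto simp: walk_set_def PiE_iff extensional_def fun_eq_iff restrict_def)
  ultimately show "f \<in> ?B" by blast
next
  fix f assume "f \<in> ?B"
  then show "f \<in> ?A"
    using assms by (auto simp: walk_set_def PiE_iff extensional_def less_Suc_eq atMost_Suc)
qed

lemma inj_on_extend_walk: "inj_on (\<lambda>f. f(Suc l := v)) (walk_set T l u x)"
proof (rule inj_onI)
  fix f g assume walks: "f \<in> walk_set T l u x" "g \<in> walk_set T l u x"
    and eq: "f(Suc l := v) = g(Suc l := v)"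
  have "f y = g y" for y
    using fun_cong[OF eq, of y] walks
    by (cases "y = Suc l") (auto simp: walk_set_def PiE_iff extensional_def)
  then show "f = g" ..
qed

lemma card_walk_set_Suc:
  assumes "finite (pverts T)" "v \<in> pverts T"
  shows "card (walk_set T (Suc l) u v) = (\<Sum>x\<in>{x \<in> pverts T. (x, v) \<in> parcs T}. card (walk_set T l u x))"
proof -
  let ?N = "{x \<in> pverts T. (x, v) \<in> parcs T}"
  let ?extend = "\<lambda>f. f(Suc l := v)"
  have penultimate: "h l = x" if "h \<in> ?extend ` walk_set T l u x" for h x
    using that by (auto simp: walk_set_def)
  have "card (walk_set T (Suc l) u v) = (\<Sum>x\<in>?N. card (?extend ` walk_set T l u x))"
    unfolding walk_set_Suc[OF assms(2)]
  proof (rule card_UN_disjoint)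
    show "\<forall>x\<in>?N. \<forall>y\<in>?N. x \<noteq> y \<longrightarrow> ?extend ` walk_set T l u x \<inter> ?extend ` walk_set T l u y = {}"
      using penultimate by blast
  qed (use assms(1) in \<open>auto intro: finite_walk_set\<close>)
  then show ?thesis by (simp add: card_image inj_on_extend_walk)
qed

lemma card_walk_set:
  assumes "finite (pverts T)" "u \<in> pverts T" "v \<in> pverts T"
  shows "real (card (walk_set T l u v)) = walk_count T l u v"
  using assms(3)
proof (induction l arbitrary: v)
  case 0
  have "walk_set T 0 u v = (if u = v then {\<lambda>x\<in>{..0}. u} else {})"
    using 0 by (auto simp: walk_set_def PiE_iff extensional_def fun_eq_iff)
  then show ?case by simp
next
  case (Suc l)
  let ?N = "{x \<in> pverts T. (x, v) \<in> parcs T}"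
  have "real (card (walk_set T (Suc l) u v)) = (\<Sum>x\<in>?N. walk_count T l u x)"
    using Suc.IH by (simp add: card_walk_set_Suc[OF assms(1) Suc.prems])
  also have "\<dots> = walk_count T (Suc l) u v"
    using assms(1) by (auto intro!: sum.mono_neutral_cong_left)
  finally show ?case .
qed

lemma hom_set_cycle_graph:
  assumes "sym (parcs T)"
  shows "hom_set (cycle_graph m) T =
    {f \<in> {..<m} \<rightarrow>\<^sub>E pverts T. \<forall>i<m. (f i, f ((i + 1) mod m)) \<in> parcs T}"
  using symD[OF assms] by (fastforce simp: hom_set_def cycle_graph_def)

lemma bij_betw_hom_set_cycle_graph:
  assumes "sym (parcs T)" "m \<ge> 1"
  shows "bij_betw (\<lambda>f. f(m := f 0)) (hom_set (cycle_graph m) T) (\<Union>u\<in>pverts T. walk_set T m u u)"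
proof (rule bij_betw_byWitness[where f' = "\<lambda>g. restrict g {..<m}"])
  note hom_set = hom_set_cycle_graph[OF assms(1)]
  let ?W = "\<Union>u\<in>pverts T. walk_set T m u u"
  show "\<forall>f\<in>hom_set (cycle_graph m) T. restrict (f(m := f 0)) {..<m} = f"
    by (auto simp: hom_set PiE_iff extensional_def fun_eq_iff restrict_def)
  show "\<forall>g\<in>?W. (restrict g {..<m})(m := restrict g {..<m} 0) = g"
    using assms(2) by (auto simp: walk_set_def PiE_iff extensional_def fun_eq_iff restrict_def)
  show "(\<lambda>f. f(m := f 0)) ` hom_set (cycle_graph m) T \<subseteq> ?W"
  proof (rule image_subsetI)
    fix f assume f: "f \<in> hom_set (cycle_graph m) T"
    have "(f i, (f(m := f 0)) (Suc i)) \<in> parcs T" if "i < m" for i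
    proof -
      have "(f i, f ((i + 1) mod m)) \<in> parcs T" using f that by (simp add: hom_set)
      then show ?thesis using that by (cases "Suc i = m") auto
    qed
    then have "f(m := f 0) \<in> walk_set T m (f 0) (f 0)" "f 0 \<in> pverts T"
      using f assms(2) by (auto simp: hom_set walk_set_def PiE_iff extensional_def)
    then show "f(m := f 0) \<in> ?W" by blast
  qed
  show "(\<lambda>g. restrict g {..<m}) ` ?W \<subseteq> hom_set (cycle_graph m) T"
  proof (rule image_subsetI)
    fix g assume "g \<in> ?W"
    then have g: "g \<in> {..m} \<rightarrow>\<^sub>E pverts T" "g m = g 0" "\<And>i. i < m \<Longrightarrow> (g i, g (Suc i)) \<in> parcs T"
      by (auto simp: walk_set_def)
    have "(restrict g {..<m} i, restrict g {..<m} ((i + 1) mod m)) \<in> parcs T" if "i < m" for i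
      using g(2) g(3)[OF that] that by (cases "Suc i = m") auto
    then show "restrict g {..<m} \<in> hom_set (cycle_graph m) T"
      using g(1) by (auto simp: hom_set)
  qed
qed

lemma card_hom_set_cycle_graph:
  assumes "pair_graph T" "m \<ge> 1"
  shows "real (card (hom_set (cycle_graph m) T)) = (\<Sum>u\<in>pverts T. walk_count T m u u)"
proof -
  have fin: "finite (pverts T)" and sym: "sym (parcs T)"
    using assms by (auto simp: pair_graph_iff)
  have "card (hom_set (cycle_graph m) T) = card (\<Union>u\<in>pverts T. walk_set T m u u)"
    using bij_betw_hom_set_cycle_graph[OF sym assms(2)] by (rule bij_betw_same_card)
  also have "\<dots> = (\<Sum>u\<in>pverts T. card (walk_set T m u u))"
    by (rule card_UN_disjoint) (simp_all add: fin finite_walk_set, auto simp: walk_set_def)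
  finally show ?thesis using fin by (simp add: card_walk_set)
qed

lemma card_hom_set_even_cycle:
  assumes "pair_graph T" "i \<ge> 1"
  shows "real (card (hom_set (cycle_graph (2 * i)) T)) = walk_moment T i"
  using card_hom_set_cycle_graph[of T "2 * i"] assms by (simp add: walk_moment_eq_trace)

lemma hom_density_even_cycle:
  assumes "pair_graph T" "i \<ge> 1"
  shows "hom_density (cycle_graph (2 * i)) T = walk_moment T i / real (card (pverts T)) ^ (2 * i)"
  using card_hom_set_even_cycle[OF assms] by (simp add: hom_density_def cycle_graph_def)

section \<open>Inequalities between walk moments\<close>

lemma Cauchy_Schwarz_ineq_double_sum:
  fixes f g :: "'a \<Rightarrow> 'b \<Rightarrow> real"
  shows "(\<Sum>x\<in>A. \<Sum>y\<in>B. f x y * g x y)\<^sup>2 \<le> (\<Sum>x\<in>A. \<Sum>y\<in>B. (f x y)\<^sup>2) * (\<Sum>x\<in>A. \<Sum>y\<in>B. (g x y)\<^sup>2)"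
  using Cauchy_Schwarz_ineq_sum[of "case_prod f" "case_prod g" "A \<times> B"]
  by (simp add: sum.cartesian_product case_prod_beta)

lemma walk_moment_log_convex:
  assumes "pair_graph T"
  shows "(walk_moment T (i + 1))\<^sup>2 \<le> walk_moment T i * walk_moment T (i + 2)"
  using Cauchy_Schwarz_ineq_double_sum[of "walk_count T i" "walk_count T (i + 2)" "pverts T" "pverts T"]
    walk_moment_add_eq[OF assms, of i "i + 2" "i + 1"]
  by (simp add: walk_moment_def del: walk_count.simps)

lemma walk_moment_double_le:
  assumes "finite (pverts T)"
  shows "walk_moment T (2 * i) \<le> (walk_moment T i)\<^sup>2"
proof -
  let ?V = "pverts T"
  have "walk_moment T (2 * i) = (\<Sum>u\<in>?V. \<Sum>v\<in>?V. (\<Sum>x\<in>?V. walk_count T i u x * walk_count T i x v)\<^sup>2)"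
    unfolding walk_moment_def using walk_count_add[OF assms, of _ i i]
    by (intro sum.cong) (auto simp: mult_2)
  also have "\<dots> \<le> (\<Sum>u\<in>?V. \<Sum>v\<in>?V. (\<Sum>x\<in>?V. (walk_count T i u x)\<^sup>2) * (\<Sum>x\<in>?V. (walk_count T i x v)\<^sup>2))"
    by (intro sum_mono Cauchy_Schwarz_ineq_sum)
  also have "\<dots> = walk_moment T i * (\<Sum>v\<in>?V. \<Sum>x\<in>?V. (walk_count T i x v)\<^sup>2)"
    by (simp add: walk_moment_def sum_product)
  also have "(\<Sum>v\<in>?V. \<Sum>x\<in>?V. (walk_count T i x v)\<^sup>2) = walk_moment T i"
    unfolding walk_moment_def by (rule sum.swap)
  finally show ?thesis by (simp add: power2_eq_square)
qed

lemma walk_total_double_ge: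
  assumes "pair_graph T"
  shows "(walk_total T l)\<^sup>2 \<le> real (card (pverts T)) * walk_total T (2 * l)"
proof -
  let ?V = "pverts T"
  let ?row = "\<lambda>x. \<Sum>v\<in>?V. walk_count T l x v"
  have "walk_total T (2 * l) = (\<Sum>u\<in>?V. \<Sum>v\<in>?V. \<Sum>x\<in>?V. walk_count T l u x * walk_count T l x v)"
    unfolding walk_total_def using walk_count_add[of T _ l l] assms
    by (intro sum.cong) (auto simp: mult_2 pair_graph_iff)
  also have "\<dots> = (\<Sum>u\<in>?V. \<Sum>v\<in>?V. \<Sum>x\<in>?V. walk_count T l x u * walk_count T l x v)"
    by (intro sum.cong refl arg_cong2[of _ _ _ _ "(*)"] walk_count_sym assms)
  also have "\<dots> = (\<Sum>u\<in>?V. \<Sum>x\<in>?V. \<Sum>v\<in>?V. walk_count T l x u * walk_count T l x v)"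
    by (rule sum.cong[OF refl]) (rule sum.swap)
  also have "\<dots> = (\<Sum>x\<in>?V. \<Sum>u\<in>?V. \<Sum>v\<in>?V. walk_count T l x u * walk_count T l x v)"
    by (rule sum.swap)
  also have "\<dots> = (\<Sum>x\<in>?V. (?row x)\<^sup>2)"
    by (simp add: power2_eq_square sum_product)
  finally have "walk_total T (2 * l) = (\<Sum>x\<in>?V. (?row x)\<^sup>2)" .
  then show ?thesis
    using Cauchy_Schwarz_ineq_sum[of "\<lambda>_. 1" ?row ?V] by (simp add: walk_total_def)
qed

lemma walk_total_sq_le:
  "(walk_total T l)\<^sup>2 \<le> (real (card (pverts T)))\<^sup>2 * walk_moment T l"
  using Cauchy_Schwarz_ineq_double_sum[of "\<lambda>_ _. 1" "walk_count T l" "pverts T" "pverts T"]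
  by (simp add: walk_total_def walk_moment_def power2_eq_square)

lemma walk_total_power2_ge:
  assumes "pair_graph T" "pverts T \<noteq> {}"
  shows "real (card (pverts T)) * (walk_moment T 1 / real (card (pverts T))) ^ (2 ^ q) \<le>
      walk_total T (2 ^ q)"
proof (induction q)
  let ?n = "real (card (pverts T))"
  have card_pos: "?n > 0" using assms by (simp add: card_gt_0_iff pair_graph_iff)
  {
    case 0
    show ?case using walk_moment_1[of T] assms by (simp add: pair_graph_iff)
  next
    case (Suc q)
    have "?n * (?n * (walk_moment T 1 / ?n) ^ (2 ^ Suc q)) = (?n * (walk_moment T 1 / ?n) ^ (2 ^ q))\<^sup>2"
      by (simp add: power2_eq_square power_add mult_2)
    also have "\<dots> \<le> (walk_total T (2 ^ q))\<^sup>2"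
      using Suc by (intro power_mono) (auto simp: walk_moment_nonneg)
    also have "\<dots> \<le> ?n * walk_total T (2 ^ Suc q)"
      using walk_total_double_ge[OF assms(1), of "2 ^ q"] by simp
    finally show ?case using card_pos by (subst (asm) mult_le_cancel_left_pos) auto
  }
qed

lemma walk_moment_power2_ge:
  assumes "pair_graph T" "pverts T \<noteq> {}"
  shows "(walk_moment T 1 / real (card (pverts T))) ^ (2 * 2 ^ q) \<le> walk_moment T (2 ^ q)"
proof -
  let ?n = "real (card (pverts T))"
  have card_pos: "?n > 0" using assms by (simp add: card_gt_0_iff pair_graph_iff)
  have "?n\<^sup>2 * (walk_moment T 1 / ?n) ^ (2 * 2 ^ q) = (?n * (walk_moment T 1 / ?n) ^ (2 ^ q))\<^sup>2"
    by (simp add: power_mult_distrib mult.commute flip: power_mult)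
  also have "\<dots> \<le> (walk_total T (2 ^ q))\<^sup>2"
    using walk_total_power2_ge[OF assms] by (intro power_mono) (auto simp: walk_moment_nonneg)
  also have "\<dots> \<le> ?n\<^sup>2 * walk_moment T (2 ^ q)" by (rule walk_total_sq_le)
  finally show ?thesis using card_pos by (subst (asm) mult_le_cancel_left_pos) auto
qed

definition edge_graph :: "'a pair_pre_digraph \<Rightarrow> bool" where
  "edge_graph T \<longleftrightarrow> pair_graph T \<and> parcs T \<noteq> {}"

lemma edge_graph_card_pos: "edge_graph T \<Longrightarrow> card (pverts T) > 0"
  by (auto simp: edge_graph_def pair_graph_iff card_gt_0_iff)

lemma walk_moment_pos:
  assumes "edge_graph T"
  shows "walk_moment T i > 0"
proof -
  have T: "pair_graph T" "finite (pverts T)" "finite (parcs T)"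
    using assms finite_subset[of "parcs T" "pverts T \<times> pverts T"]
    by (auto simp: edge_graph_def pair_graph_iff)
  have "walk_moment T i > 0 \<and> walk_moment T (i + 1) > 0"
  proof (induction i)
    case 0
    show ?case
      using T assms edge_graph_card_pos[OF assms]
      by (simp add: walk_moment_0 walk_moment_1_eq_card_parcs card_gt_0_iff edge_graph_def del: One_nat_def)
  next
    case (Suc i)
    have "0 < (walk_moment T (i + 1))\<^sup>2" using Suc by auto
    also have "\<dots> \<le> walk_moment T i * walk_moment T (i + 2)"
      by (rule walk_moment_log_convex[OF T(1)])
    finally show ?case using Suc by (auto simp: zero_less_mult_iff)
  qed
  then show ?thesis ..
qed

lemma walk_moment_ge_1:
  assumes "edge_graph T" "i \<ge> 1"
  shows "walk_moment T i \<ge> 1"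
proof -
  have "walk_moment T i = real (card (hom_set (cycle_graph (2 * i)) T))"
    using assms by (simp add: card_hom_set_even_cycle edge_graph_def)
  with walk_moment_pos[OF assms(1), of i] show ?thesis by simp
qed

section \<open>Logarithmic cycle densities\<close>

lemma convex_seq_ge_tangent:
  fixes f :: "nat \<Rightarrow> real"
  assumes "\<And>j. 2 * f (j + 1) \<le> f j + f (j + 2)"
  shows "f i + real m * (f (i + 1) - f i) \<le> f (i + m)"
proof (induction m)
  case (Suc m)
  have "f (j + 1) - f j \<le> f (Suc j + 1) - f (Suc j)" for j
    using assms[of j] by simp
  then have "incseq (\<lambda>j. f (j + 1) - f j)" by (rule incseq_SucI)
  then have "f (i + 1) - f i \<le> f (i + m + 1) - f (i + m)"
    by (rule incseqD) simp
  with Suc.IH show ?case by (simp add: algebra_simps)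
qed simp

lemma convex_seq_ratio_antimono:
  fixes f :: "nat \<Rightarrow> real"
  assumes convex: "\<And>j. 2 * f (j + 1) \<le> f j + f (j + 2)" and double: "\<And>l. f (2 * l) \<le> 2 * f l"
    and "1 \<le> a" "a \<le> b"
  shows "real a * f b \<le> real b * f a"
  using assms(4)
proof (induction b rule: dec_induct)
  case (step b)
  have "real b * f (b + 1) \<le> real (b + 1) * f b"
    using convex_seq_ge_tangent[OF convex, of b b, folded mult_2] double[of b]
    by (simp add: algebra_simps)
  then have "real a * (real b * f (b + 1)) \<le> real a * (real (b + 1) * f b)"
    by (rule mult_left_mono) simp
  also have "\<dots> = real (b + 1) * (real a * f b)" by simp
  also have "\<dots> \<le> real (b + 1) * (real b * f a)"
    using step.IH by (rule mult_left_mono) simp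
  finally have "real b * (real a * f (Suc b)) \<le> real b * (real (Suc b) * f a)"
    by (simp add: mult_ac)
  then show ?case using step.hyps assms(3) by (subst (asm) mult_le_cancel_left_pos) auto
qed simp

lemma ln_walk_moment_convex:
  assumes "edge_graph T"
  shows "2 * ln (walk_moment T (i + 1)) \<le> ln (walk_moment T i) + ln (walk_moment T (i + 2))"
proof -
  note pos = walk_moment_pos[OF assms]
  have "ln ((walk_moment T (i + 1))\<^sup>2) \<le> ln (walk_moment T i * walk_moment T (i + 2))"
    using pos[of "i + 1"] walk_moment_log_convex[of T i] assms
    by (intro ln_mono) (auto simp: edge_graph_def)
  then show ?thesis
    using pos[of i] pos[of "i + 1"] pos[of "i + 2"]
    by (simp add: ln_mult_pos ln_realpow del: add_2_eq_Suc')
qed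

lemma ln_walk_moment_double_le:
  assumes "edge_graph T"
  shows "ln (walk_moment T (2 * i)) \<le> 2 * ln (walk_moment T i)"
proof -
  have "ln (walk_moment T (2 * i)) \<le> ln ((walk_moment T i)\<^sup>2)"
    using walk_moment_pos[OF assms] walk_moment_double_le[of T i] assms
    by (intro ln_mono) (auto simp: edge_graph_def pair_graph_iff)
  then show ?thesis using walk_moment_pos[OF assms, of i] by (simp add: ln_realpow)
qed

text \<open>Submultiplicativity of the Frobenius norm caps the growth rate of the convex sequence
  \<open>ln (walk_moment T i)\<close>; this replaces the comparison with the largest eigenvalue.\<close>

lemma ln_walk_moment_ratio_antimono:
  assumes "edge_graph T" "1 \<le> a" "a \<le> b"
  shows "real a * ln (walk_moment T b) \<le> real b * ln (walk_moment T a)"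
  using ln_walk_moment_convex[OF assms(1)] ln_walk_moment_double_le[OF assms(1)] assms(2,3)
  by (rule convex_seq_ratio_antimono)

lemma ln_walk_moment_sidorenko:
  assumes "edge_graph T" "i \<ge> 1"
  shows "2 * real i * (ln (walk_moment T 1) - ln (real (card (pverts T)))) \<le> ln (walk_moment T i)"
proof -
  let ?n = "real (card (pverts T))"
  define m :: nat where "m = 2 ^ i"
  have m_bounds: "i \<le> m" "m > 0" by (auto simp: m_def intro: less_imp_le)
  have pos: "walk_moment T 1 > 0" "?n > 0"
    using walk_moment_pos[OF assms(1)] edge_graph_card_pos[OF assms(1)] by auto
  have "real (2 * m) * (ln (walk_moment T 1) - ln ?n) = ln ((walk_moment T 1 / ?n) ^ (2 * m))"
    using pos by (simp add: ln_realpow ln_div)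
  also have "\<dots> \<le> ln (walk_moment T m)"
  proof (rule ln_mono)
    have "pverts T \<noteq> {}" using pos(2) by auto
    then show "(walk_moment T 1 / ?n) ^ (2 * m) \<le> walk_moment T m"
      using walk_moment_power2_ge[of T i] assms(1) by (simp add: edge_graph_def m_def)
  qed (use pos walk_moment_pos[OF assms(1), of m] in auto)
  finally have "real i * (real (2 * m) * (ln (walk_moment T 1) - ln ?n)) \<le>
      real i * ln (walk_moment T m)"
    by (rule mult_left_mono) simp
  also have "\<dots> \<le> real m * ln (walk_moment T i)"
    using ln_walk_moment_ratio_antimono[OF assms m_bounds(1)] .
  finally have "real m * (2 * real i * (ln (walk_moment T 1) - ln ?n)) \<le>
      real m * ln (walk_moment T i)"
    by (simp add: mult_ac)
  then show ?thesis using m_bounds(2) by (subst (asm) mult_le_cancel_left_pos) auto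
qed

definition log_cycle_density :: "'a pair_pre_digraph \<Rightarrow> nat \<Rightarrow> real" where
  "log_cycle_density T i = ln (hom_density (cycle_graph (2 * i)) T)"

lemma hom_density_even_cycle_pos:
  assumes "edge_graph T" "i \<ge> 1"
  shows "hom_density (cycle_graph (2 * i)) T > 0"
  using assms edge_graph_card_pos[OF assms(1)] walk_moment_pos[of T i]
  by (simp add: edge_graph_def hom_density_even_cycle)

lemma log_cycle_density_eq:
  assumes "edge_graph T" "i \<ge> 1"
  shows "log_cycle_density T i = ln (walk_moment T i) - 2 * real i * ln (real (card (pverts T)))"
  using assms edge_graph_card_pos[OF assms(1)] walk_moment_pos[of T i]
  by (simp add: edge_graph_def log_cycle_density_def hom_density_even_cycle ln_div ln_realpow)

lemma log_cycle_density_convex: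
  assumes "edge_graph T" "i \<ge> 1"
  shows "2 * log_cycle_density T (i + 1) \<le> log_cycle_density T i + log_cycle_density T (i + 2)"
  using ln_walk_moment_convex[OF assms(1), of i] assms
  by (simp add: log_cycle_density_eq algebra_simps del: add_2_eq_Suc')

lemma log_cycle_density_ratio_antimono:
  assumes "edge_graph T" "1 \<le> a" "a \<le> b"
  shows "real a * log_cycle_density T b \<le> real b * log_cycle_density T a"
  using ln_walk_moment_ratio_antimono[OF assms] assms
  by (simp add: log_cycle_density_eq algebra_simps)

lemma log_cycle_density_sidorenko:
  assumes "edge_graph T" "i \<ge> 1"
  shows "2 * real i * log_cycle_density T 1 \<le> log_cycle_density T i"
  using ln_walk_moment_sidorenko[OF assms] assms
  by (simp add: log_cycle_density_eq algebra_simps)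

lemma log_cycle_density_ge_tangent:
  assumes "edge_graph T" "i \<ge> 1"
  shows "(1 - real i) * ln (real (card (pverts T))) + real i * log_cycle_density T 1 \<le>
      log_cycle_density T i"
  using convex_seq_ge_tangent[where f = "\<lambda>i. ln (walk_moment T i)" and i = 0 and m = i,
      OF ln_walk_moment_convex[OF assms(1)]] assms
  by (simp add: log_cycle_density_eq walk_moment_0 edge_graph_def pair_graph_iff algebra_simps)

section \<open>The divisor bound\<close>

lemma card_divisors_mult_le:
  assumes "m > 0" "n > (0::nat)"
  shows "card {d. d dvd m * n} \<le> card {d. d dvd m} * card {d. d dvd n}"
proof -
  have fin: "finite {d. d dvd m}" "finite {d. d dvd n}" using assms by auto
  have "{d. d dvd m * n} \<subseteq> (\<lambda>(a, b). a * b) ` ({d. d dvd m} \<times> {d. d dvd n})"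
    by (auto dest!: division_decomp)
  from surj_card_le[OF _ this] show ?thesis
    using fin by (simp add: card_cartesian_product)
qed

lemma card_divisors_prime_power_le:
  assumes "prime (p::nat)"
  shows "card {d. d dvd p ^ e} \<le> e + 1"
proof -
  have "{d. d dvd p ^ e} \<subseteq> (\<lambda>i. p ^ i) ` {..e}"
    using assms by (auto simp: divides_primepow_nat)
  from surj_card_le[OF _ this] show ?thesis by simp
qed

lemma card_divisors_prod_prime_powers_le:
  assumes "finite S" "\<And>p. p \<in> S \<Longrightarrow> prime (p::nat)"
  shows "card {d. d dvd (\<Prod>p\<in>S. p ^ e p)} \<le> (\<Prod>p\<in>S. e p + 1)"
  using assms
proof (induction S rule: finite_induct)
  case (insert p S)
  have pos: "0 < q ^ e q" if "q \<in> insert p S" for q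
    using prime_gt_0_nat[OF insert.prems[OF that]] by simp
  have "card {d. d dvd p ^ e p * (\<Prod>p\<in>S. p ^ e p)} \<le>
      card {d. d dvd p ^ e p} * card {d. d dvd (\<Prod>p\<in>S. p ^ e p)}"
    using pos by (intro card_divisors_mult_le prod_pos) auto
  also have "\<dots> \<le> (e p + 1) * (\<Prod>p\<in>S. e p + 1)"
    using insert by (intro mult_mono card_divisors_prime_power_le) auto
  finally show ?case using insert.hyps by simp
qed simp

lemma power_le_const_mult_exp: "\<exists>B\<ge>1. \<forall>e. (real e + 1) ^ r \<le> B * 2 ^ e"
proof -
  have "(\<lambda>e. (real e + 1) ^ r / 2 ^ e) \<longlonglongrightarrow> 0" by real_asymp
  then have "Bseq (\<lambda>e. (real e + 1) ^ r / 2 ^ e)"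
    by (intro convergent_imp_Bseq) (auto simp: convergent_def)
  then obtain K where K: "\<And>e. norm ((real e + 1) ^ r / 2 ^ e) \<le> K" by (auto simp: Bseq_def)
  have "(real e + 1) ^ r \<le> max K 1 * 2 ^ e" for e
  proof -
    have "(real e + 1) ^ r / 2 ^ e \<le> max K 1" using K[of e] by auto
    then show ?thesis by (simp add: divide_simps)
  qed
  then show ?thesis by (intro exI[of _ "max K 1"]) auto
qed

lemma power_le_const_mult_prime_power:
  "\<exists>B\<ge>1. \<forall>p e. prime p \<longrightarrow> (real e + 1) ^ r \<le> (if p < 2 ^ r then B else 1) * real p ^ e"
proof -
  obtain B where B: "B \<ge> 1" "\<And>e. (real e + 1) ^ r \<le> B * 2 ^ e"
    using power_le_const_mult_exp by blast
  have "(real e + 1) ^ r \<le> (if p < 2 ^ r then B else 1) * real p ^ e" if "prime p" for p e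
  proof (cases "p < 2 ^ r")
    case True
    have "B * 2 ^ e \<le> B * real p ^ e"
      using B(1) prime_ge_2_nat[OF that] by (intro mult_left_mono power_mono) auto
    with B(2)[of e] True show ?thesis by simp
  next
    case False
    have "e + 1 \<le> 2 ^ e" by (metis Suc_eq_plus1 Suc_leI less_exp)
    then have "(e + 1) ^ r \<le> (2 ^ e) ^ r" by (rule power_mono) simp
    also have "\<dots> = (2 ^ r) ^ e" by (simp add: mult.commute flip: power_mult)
    also have "\<dots> \<le> p ^ e" using False by (intro power_mono) auto
    finally have "real ((e + 1) ^ r) \<le> real (p ^ e)" by (rule of_nat_mono)
    with False show ?thesis by (simp add: add.commute)
  qed
  with B(1) show ?thesis by blast
qed

text \<open>Only the boundedly many primes below \<open>2 ^ r\<close> contribute to the constant.\<close>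

lemma card_divisors_power_le:
  "\<exists>C\<ge>1. \<forall>m>0. real (card {d. d dvd m}) ^ r \<le> C * real m"
proof -
  define N :: nat where "N = 2 ^ r"
  obtain B where B: "B \<ge> 1"
    and prime_power: "\<And>p e. prime p \<Longrightarrow> (real e + 1) ^ r \<le> (if p < N then B else 1) * real p ^ e"
    using power_le_const_mult_prime_power[of r] unfolding N_def by blast
  have "real (card {d. d dvd m}) ^ r \<le> B ^ N * real m" if "m > 0" for m
  proof -
    let ?S = "prime_factors m"
    let ?e = "\<lambda>p. multiplicity p m"
    have factorization: "m = (\<Prod>p\<in>?S. p ^ ?e p)" using that by (rule prime_factorization_nat)
    have "card {d. d dvd (\<Prod>p\<in>?S. p ^ ?e p)} \<le> (\<Prod>p\<in>?S. ?e p + 1)"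
      by (rule card_divisors_prod_prime_powers_le) auto
    then have "real (card {d. d dvd m}) \<le> real (\<Prod>p\<in>?S. ?e p + 1)"
      unfolding factorization[symmetric] by (rule of_nat_mono)
    then have "real (card {d. d dvd m}) \<le> (\<Prod>p\<in>?S. real (?e p) + 1)"
      by (simp add: add.commute)
    then have "real (card {d. d dvd m}) ^ r \<le> (\<Prod>p\<in>?S. (real (?e p) + 1) ^ r)"
      unfolding prod_power_distrib[symmetric] by (rule power_mono) simp
    also have "\<dots> \<le> (\<Prod>p\<in>?S. (if p < N then B else 1) * real p ^ ?e p)"
      by (intro prod_mono conjI prime_power) auto
    also have "\<dots> = (\<Prod>p\<in>?S. if p < N then B else 1) * real m"
      by (simp add: prod.distrib flip: factorization of_nat_power of_nat_prod)
    also have "(\<Prod>p\<in>?S. if p < N then B else 1) = B ^ card (?S \<inter> {..<N})"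
      by (simp add: prod.If_cases lessThan_def)
    also have "\<dots> \<le> B ^ N"
      using B card_mono[of "{..<N}" "?S \<inter> {..<N}"] by (intro power_increasing) auto
    finally show ?thesis using that by (simp add: mult_right_mono)
  qed
  with B show ?thesis by (intro exI[of _ "B ^ N"]) auto
qed

definition max_divisors :: "nat \<Rightarrow> nat" where
  "max_divisors n = Max ((\<lambda>m. card {d. d dvd m}) ` {1..n})"

lemma card_divisors_le_max_divisors:
  "0 < m \<Longrightarrow> m \<le> n \<Longrightarrow> card {d. d dvd m} \<le> max_divisors n"
  unfolding max_divisors_def by (intro Max_ge) auto

lemma max_divisors_pos: "n > 0 \<Longrightarrow> max_divisors n > 0"
  using card_divisors_le_max_divisors[of 1 n] by simp

lemma max_divisors_attained:
  assumes "n > 0"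
  obtains m where "0 < m" "m \<le> n" "max_divisors n = card {d. d dvd m}"
proof -
  have "max_divisors n \<in> (\<lambda>m. card {d. d dvd m}) ` {1..n}"
    unfolding max_divisors_def using assms by (intro Max_in) auto
  then obtain m where "m \<in> {1..n}" "max_divisors n = card {d. d dvd m}" by blast
  then show thesis by (intro that[of m]) auto
qed

lemma ln_max_divisors_le:
  assumes "r > 0"
  shows "\<exists>c. \<forall>n>0. ln (real (max_divisors n)) \<le> (c + ln (real n)) / real r"
proof -
  obtain C where C: "C \<ge> 1" "\<And>m. m > 0 \<Longrightarrow> real (card {d. d dvd m}) ^ r \<le> C * real m"
    using card_divisors_power_le[of r] by blast
  have "ln (real (max_divisors n)) \<le> (ln C + ln (real n)) / real r" if "n > 0" for n
  proof -
    obtain m where m: "0 < m" "m \<le> n" "max_divisors n = card {d. d dvd m}"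
      using max_divisors_attained[OF \<open>n > 0\<close>] .
    have "real (max_divisors n) ^ r \<le> C * real n"
      using C(2)[OF m(1)] C(1) m by (auto intro: order.trans mult_left_mono)
    then have "ln (real (max_divisors n) ^ r) \<le> ln (C * real n)"
      using max_divisors_pos[OF that] by (intro ln_mono) auto
    then show ?thesis
      using max_divisors_pos[OF that] that C(1) assms
      by (simp add: ln_realpow ln_mult_pos field_simps)
  qed
  then show ?thesis by blast
qed

lemma ln_max_divisors_over_ln_tendsto_0:
  "(\<lambda>n. ln (real (max_divisors n)) / ln (real n)) \<longlonglongrightarrow> 0"
proof (rule order_tendstoI)
  fix \<epsilon> :: real assume "\<epsilon> > 0"
  then obtain q where "1 / real (Suc q) < \<epsilon>" by (rule nat_approx_posE)
  then obtain r :: nat where r: "r > 0" "1 / real r < \<epsilon>" using zero_less_Suc by metis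
  obtain c where bound: "\<And>n. n > 0 \<Longrightarrow> ln (real (max_divisors n)) \<le> (c + ln (real n)) / real r"
    using ln_max_divisors_le[OF r(1)] by blast
  have "((\<lambda>n. (c / ln (real n) + 1) / real r) \<longlonglongrightarrow> (0 + 1) / real r)"
    by (intro tendsto_intros real_tendsto_divide_at_top[OF tendsto_const]
        filterlim_compose[OF ln_at_top filterlim_real_sequentially]) (use r in auto)
  then have "\<forall>\<^sub>F n in sequentially. (c / ln (real n) + 1) / real r < \<epsilon>"
    using r(2) by (intro order_tendstoD) auto
  with eventually_gt_at_top[of 1]
  show "\<forall>\<^sub>F n in sequentially. ln (real (max_divisors n)) / ln (real n) < \<epsilon>"
  proof eventually_elim
    case (elim n)
    have "ln (real (max_divisors n)) / ln (real n) \<le> (c / ln (real n) + 1) / real r"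
      using bound[of n] elim(1) r(1) by (simp add: field_simps)
    with elim(2) show ?case by simp
  qed
next
  fix \<epsilon> :: real assume "\<epsilon> < 0"
  have "0 \<le> ln (real (max_divisors n)) / ln (real n)" if "n > 0" for n
    using max_divisors_pos[OF that] that by simp
  with \<open>\<epsilon> < 0\<close> show "\<forall>\<^sub>F n in sequentially. \<epsilon> < ln (real (max_divisors n)) / ln (real n)"
    by (intro eventually_mono[OF eventually_gt_at_top[of 0]]) (rule less_le_trans)
qed

section \<open>Small products modulo a prime\<close>

definition small_product_graph :: "nat \<Rightarrow> nat \<Rightarrow> nat pair_pre_digraph" where
  "small_product_graph P x =
     \<lparr> pverts = {1..<P},
       parcs = {(u, v). u \<in> {1..<P} \<and> v \<in> {1..<P} \<and> u \<noteq> v \<and> u * v mod P \<le> x} \<rparr>"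

lemma pair_graph_small_product_graph: "pair_graph (small_product_graph P x)"
  by (auto simp: pair_graph_iff small_product_graph_def sym_def irrefl_def mult.commute)

lemma bij_betw_mult_mod_prime:
  assumes "prime (P::nat)" "u \<in> {1..<P}"
  shows "bij_betw (\<lambda>v. u * v mod P) {1..<P} {1..<P}"
proof -
  have not_dvd_u: "\<not> P dvd u" using assms(2) by (auto dest: dvd_imp_le)
  then have "coprime u P" using assms(1) prime_imp_coprime coprime_commute by blast
  then have "v = w" if "v \<in> {1..<P}" "w \<in> {1..<P}" "u * v mod P = u * w mod P" for v w
    using that cong_mult_lcancel_nat[of u P v w] by (simp add: cong_def)
  then have inj: "inj_on (\<lambda>v. u * v mod P) {1..<P}" by (rule inj_onI)
  have "u * v mod P \<in> {1..<P}" if "v \<in> {1..<P}" for v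
  proof -
    have "\<not> P dvd u * v" using assms(1) not_dvd_u that by (auto simp: prime_dvd_mult_iff dest: dvd_imp_le)
    then show ?thesis using that by (auto simp: dvd_eq_mod_eq_0 Suc_le_eq intro: Nat.gr0I)
  qed
  then have "(\<lambda>v. u * v mod P) ` {1..<P} \<subseteq> {1..<P}" by (rule image_subsetI)
  with inj show ?thesis
    using endo_inj_surj[of "{1..<P}"] by (simp add: bij_betw_def)
qed

lemma card_mult_mod_prime_le:
  assumes "prime (P::nat)" "u \<in> {1..<P}" "x < P"
  shows "card {v \<in> {1..<P}. u * v mod P \<le> x} = x"
proof -
  note bij = bij_betw_mult_mod_prime[OF assms(1,2)]
  have "(\<lambda>v. u * v mod P) ` {v \<in> {1..<P}. u * v mod P \<le> x} =
      (\<lambda>v. u * v mod P) ` {1..<P} \<inter> {..x}"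
    by blast
  also have "\<dots> = {1..x}" unfolding bij_betw_imp_surj_on[OF bij] using assms(3) by auto
  finally have "bij_betw (\<lambda>v. u * v mod P) {v \<in> {1..<P}. u * v mod P \<le> x} {1..x}"
    using bij_betw_imp_inj_on[OF bij] by (intro bij_betw_imageI) (auto intro: inj_on_subset)
  then show ?thesis using bij_betw_same_card by fastforce
qed

lemma card_parcs_small_product_graph_ge:
  assumes "prime P" "x < P"
  shows "(P - 1) * (x - 1) \<le> card (parcs (small_product_graph P x))"
proof -
  let ?N = "\<lambda>u. {v \<in> {1..<P}. u * v mod P \<le> x}"
  have "(P - 1) * (x - 1) = (\<Sum>u\<in>{1..<P}. x - 1)" by simp
  also have "\<dots> \<le> (\<Sum>u\<in>{1..<P}. card (?N u - {u}))"
  proof (rule sum_mono)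
    fix u assume "u \<in> {1..<P}"
    then have "card (?N u) = x" using assms by (intro card_mult_mod_prime_le)
    then show "x - 1 \<le> card (?N u - {u})"
      using diff_card_le_card_Diff[of "{u}" "?N u"] by simp
  qed
  also have "\<dots> = card (Sigma {1..<P} (\<lambda>u. ?N u - {u}))" by (rule card_SigmaI[symmetric]) auto
  also have "Sigma {1..<P} (\<lambda>u. ?N u - {u}) = parcs (small_product_graph P x)"
    by (auto simp: small_product_graph_def)
  finally show ?thesis .
qed

lemma edge_graph_small_product_graph:
  assumes "prime P" "2 \<le> x" "x < P"
  shows "edge_graph (small_product_graph P x)"
proof -
  have "0 < (P - 1) * (x - 1)" using assms by simp
  also have "\<dots> \<le> card (parcs (small_product_graph P x))"
    using assms(1,3) by (rule card_parcs_small_product_graph_ge)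
  finally show ?thesis using pair_graph_small_product_graph by (auto simp: edge_graph_def)
qed

definition edge_product :: "nat \<Rightarrow> (nat \<Rightarrow> nat) \<Rightarrow> nat \<Rightarrow> nat" where
  "edge_product P f l = f l * f (Suc l) mod P"

lemma edge_product_bounds:
  assumes "prime P" "f \<in> walk_set (small_product_graph P x) m u v" "l < m"
  shows "edge_product P f l \<in> {1..x}"
proof -
  have "(f l, f (Suc l)) \<in> parcs (small_product_graph P x)"
    using assms(2,3) by (simp add: walk_set_def)
  then have "f l \<in> {1..<P}" "f (Suc l) \<in> {1..<P}" "edge_product P f l \<le> x"
    by (auto simp: small_product_graph_def edge_product_def)
  moreover from this have "edge_product P f l \<in> {1..<P}"
    using bij_betwE[OF bij_betw_mult_mod_prime[OF assms(1)]] by (simp add: edge_product_def)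
  ultimately show ?thesis by simp
qed

lemma walk_eqI_edge_product:
  assumes "prime P"
    and f: "f \<in> walk_set (small_product_graph P x) m u v"
    and g: "g \<in> walk_set (small_product_graph P x) m u v"
    and eq: "\<And>l. l < m \<Longrightarrow> edge_product P f l = edge_product P g l"
  shows "f = g"
proof -
  have vertex: "h l \<in> {1..<P}" if "h \<in> walk_set (small_product_graph P x) m u v" "l \<le> m" for h l
    using that by (auto simp: walk_set_def small_product_graph_def PiE_iff)
  have "f l = g l" if "l \<le> m" for l
    using that
  proof (induction l)
    case 0
    then show ?case using f g by (simp add: walk_set_def)
  next
    case (Suc l)
    have "f l * f (Suc l) mod P = f l * g (Suc l) mod P"
      using eq[of l] Suc by (simp add: edge_product_def)
    moreover have "inj_on (\<lambda>v. f l * v mod P) {1..<P}"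
      using vertex[OF f, of l] Suc.prems bij_betw_mult_mod_prime[OF assms(1)] bij_betw_imp_inj_on
      by auto
    ultimately show ?case
      using vertex[OF f Suc.prems] vertex[OF g Suc.prems] by (auto dest: inj_onD)
  qed
  then show ?thesis using f g by (auto simp: walk_set_def intro: PiE_ext)
qed

lemma prod_edge_product_cong:
  assumes "f (2 * i) = f 0"
  shows "[\<Prod>l<i. edge_product P f (2 * l) = \<Prod>l<i. edge_product P f (2 * l + 1)] (mod P)"
proof -
  have shift: "(\<Prod>l<i. f (2 * l)) = (\<Prod>l<i. f (2 * Suc l))"
  proof (cases i)
    case (Suc j)
    have "(\<Prod>l<Suc j. f (2 * l)) = f 0 * (\<Prod>l<j. f (2 * Suc l))"
      by (subst prod.lessThan_Suc_shift) simp
    then show ?thesis using assms by (simp add: Suc mult.commute)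
  qed simp
  have "[\<Prod>l<i. edge_product P f (2 * l) = \<Prod>l<i. f (2 * l) * f (2 * l + 1)] (mod P)"
    by (simp add: cong_def edge_product_def mod_prod_eq)
  also have "(\<Prod>l<i. f (2 * l) * f (2 * l + 1)) = (\<Prod>l<i. f (2 * l + 1) * f (2 * Suc l))"
    unfolding prod.distrib shift by (rule mult.commute)
  also have "[\<dots> = \<Prod>l<i. edge_product P f (2 * l + 1)] (mod P)"
    by (simp add: cong_def edge_product_def mod_prod_eq)
  finally show ?thesis .
qed

lemma prod_edge_product_eq:
  assumes "prime P" "x ^ i < P" and f: "f \<in> walk_set (small_product_graph P x) (2 * i) u u"
  shows "(\<Prod>l<i. edge_product P f (2 * l)) = (\<Prod>l<i. edge_product P f (2 * l + 1))"
proof -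
  have prod_less: "(\<Prod>l<i. edge_product P f (h l)) < P" if "\<And>l. l < i \<Longrightarrow> h l < 2 * i" for h
  proof -
    have "(\<Prod>l<i. edge_product P f (h l)) \<le> (\<Prod>l<i. x)"
      using edge_product_bounds[OF assms(1) f] that by (intro prod_mono) auto
    with assms(2) show ?thesis by simp
  qed
  have "f (2 * i) = f 0" using f by (simp add: walk_set_def)
  from prod_edge_product_cong[OF this, of P] show ?thesis
    using prod_less[of "\<lambda>l. 2 * l"] prod_less[of "\<lambda>l. 2 * l + 1"] by (simp add: cong_def)
qed

lemma inj_on_edge_products:
  assumes "prime P"
  shows "inj_on (\<lambda>f. (\<lambda>l\<in>{..<i}. edge_product P f (2 * l), \<lambda>l\<in>{..<i}. edge_product P f (2 * l + 1)))
    (walk_set (small_product_graph P x) (2 * i) u v)" (is "inj_on ?\<Phi> ?W")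
proof (rule inj_onI)
  fix f g assume f: "f \<in> ?W" and g: "g \<in> ?W" and eq: "?\<Phi> f = ?\<Phi> g"
  have "edge_product P f (2 * l) = edge_product P g (2 * l)"
    "edge_product P f (2 * l + 1) = edge_product P g (2 * l + 1)" if "l < i" for l
    using eq that by (auto simp: fun_eq_iff restrict_def split: if_splits)
  then have "edge_product P f l = edge_product P g l" if "l < 2 * i" for l
    using that by (cases "even l") (auto elim!: evenE oddE)
  with assms f g show "f = g" by (rule walk_eqI_edge_product)
qed

lemma divisor_tuples_bound:
  fixes x i :: nat
  defines "\<D> \<equiv> SIGMA c:{..<i} \<rightarrow>\<^sub>E {1..x}. {..<i} \<rightarrow>\<^sub>E {d. d dvd (\<Prod>l<i. c l)}"
  shows "finite \<D>" and "card \<D> \<le> (x * max_divisors (x ^ i)) ^ i"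
proof -
  let ?C = "{..<i} \<rightarrow>\<^sub>E {1..x}"
  have prod_bounds: "0 < (\<Prod>l<i. c l)" "(\<Prod>l<i. c l) \<le> x ^ i" if "c \<in> ?C" for c
  proof -
    show "0 < (\<Prod>l<i. c l)" using that by (intro prod_pos) (auto simp: PiE_iff Suc_le_eq)
    have "(\<Prod>l<i. c l) \<le> (\<Prod>l<i. x)" using that by (intro prod_mono) (auto simp: PiE_iff)
    then show "(\<Prod>l<i. c l) \<le> x ^ i" by simp
  qed
  have fin: "finite ?C" "\<And>c. c \<in> ?C \<Longrightarrow> finite ({..<i} \<rightarrow>\<^sub>E {d. d dvd (\<Prod>l<i. c l)})"
    using prod_bounds(1) by (auto intro!: finite_PiE)
  then show "finite \<D>" unfolding \<D>_def by (rule finite_SigmaI)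
  have "card \<D> = (\<Sum>c\<in>?C. card {d. d dvd (\<Prod>l<i. c l)} ^ i)"
    unfolding \<D>_def using fin by (simp add: card_PiE)
  also have "\<dots> \<le> (\<Sum>c\<in>?C. max_divisors (x ^ i) ^ i)"
    using prod_bounds by (intro sum_mono power_mono card_divisors_le_max_divisors) auto
  also have "\<dots> = (x * max_divisors (x ^ i)) ^ i"
    by (simp add: card_PiE power_mult_distrib)
  finally show "card \<D> \<le> (x * max_divisors (x ^ i)) ^ i" .
qed

text \<open>A closed walk is determined by its start and the products along its edges, and by
  \<open>prod_edge_product_eq\<close> those along the odd edges divide the product of those along the even ones.\<close>

lemma card_closed_walks_small_product_graph_le:
  assumes "prime P" "x ^ i < P"
  shows "card (walk_set (small_product_graph P x) (2 * i) u u) \<le> (x * max_divisors (x ^ i)) ^ i"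
proof -
  let ?W = "walk_set (small_product_graph P x) (2 * i) u u"
  let ?\<Phi> = "\<lambda>f. (\<lambda>l\<in>{..<i}. edge_product P f (2 * l), \<lambda>l\<in>{..<i}. edge_product P f (2 * l + 1))"
  let ?\<D> = "SIGMA c:{..<i} \<rightarrow>\<^sub>E {1..x}. {..<i} \<rightarrow>\<^sub>E {d. d dvd (\<Prod>l<i. c l)}"
  have "?\<Phi> ` ?W \<subseteq> ?\<D>"
  proof (rule image_subsetI)
    fix f assume f: "f \<in> ?W"
    have "edge_product P f (2 * l + 1) dvd (\<Prod>l<i. edge_product P f (2 * l))" if "l < i" for l
      unfolding prod_edge_product_eq[OF assms f] using that by (intro dvd_prodI) auto
    then show "?\<Phi> f \<in> ?\<D>"
      using edge_product_bounds[OF assms(1) f] by auto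
  qed
  then have "card ?W \<le> card ?\<D>"
    using divisor_tuples_bound(1) by (rule card_inj_on_le[OF inj_on_edge_products[OF assms(1)]])
  also have "\<dots> \<le> (x * max_divisors (x ^ i)) ^ i"
    by (rule divisor_tuples_bound(2))
  finally show ?thesis .
qed

lemma walk_moment_small_product_graph_le:
  assumes "prime P" "x ^ i < P"
  shows "walk_moment (small_product_graph P x) i \<le>
      real (P - 1) * real ((x * max_divisors (x ^ i)) ^ i)"
proof -
  let ?G = "small_product_graph P x"
  have "walk_moment ?G i = (\<Sum>u\<in>pverts ?G. real (card (walk_set ?G (2 * i) u u)))"
    unfolding walk_moment_eq_trace[OF pair_graph_small_product_graph]
    by (intro sum.cong refl card_walk_set[symmetric]) (auto simp: small_product_graph_def)
  also have "\<dots> \<le> (\<Sum>u\<in>pverts ?G. real ((x * max_divisors (x ^ i)) ^ i))"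
    by (intro sum_mono of_nat_mono card_closed_walks_small_product_graph_le assms)
  also have "\<dots> = real (P - 1) * real ((x * max_divisors (x ^ i)) ^ i)"
    by (simp add: small_product_graph_def)
  finally show ?thesis .
qed

text \<open>If \<open>P\<close> is about \<open>x ^ j\<close>, the graph behaves as if it had one eigenvalue \<open>x\<close> and about
  \<open>P\<close> eigenvalues of size \<open>sqrt x\<close>, so that the density of the \<open>2 i\<close>-cycle has order
  \<open>max (x ^ (2 * i)) (P * x ^ i) / P ^ (2 * i)\<close>; this is the exponent of \<open>x\<close>.\<close>

definition small_product_exponent :: "nat \<Rightarrow> nat \<Rightarrow> real" where
  "small_product_exponent j i = real i + max (real i) (real j) - 2 * real i * real j"

locale small_product_graph_sequence =
  fixes j :: nat and P x :: "nat \<Rightarrow> nat"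
  assumes j_ge_1: "j \<ge> 1" and prime_P: "\<And>n. prime (P n)" and x_ge_2: "\<And>n. x n \<ge> 2"
    and P_gt: "\<And>n. x n ^ j < P n" and P_le: "\<And>n. P n \<le> (x n + 1) ^ j"
    and x_at_top: "filterlim x at_top sequentially"
begin

abbreviation G :: "nat \<Rightarrow> nat pair_pre_digraph" where
  "G n \<equiv> small_product_graph (P n) (x n)"

abbreviation log_x :: "nat \<Rightarrow> real" where
  "log_x n \<equiv> ln (real (x n))"

abbreviation log_order :: "nat \<Rightarrow> real" where
  "log_order n \<equiv> ln (real (P n - 1))"

abbreviation log_edge_bound :: "nat \<Rightarrow> real" where
  "log_edge_bound n \<equiv> log_x n - ln 2 - log_order n"

lemma log_x_pos: "log_x n > 0"
  using x_ge_2[of n] by simp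

lemma log_x_at_top: "filterlim log_x at_top sequentially"
  by (intro filterlim_compose[OF ln_at_top] filterlim_compose[OF filterlim_real_sequentially] x_at_top)

lemma const_over_log_x_tendsto_0: "(\<lambda>n. c / log_x n) \<longlonglongrightarrow> 0"
  using tendsto_const log_x_at_top by (rule real_tendsto_divide_at_top)

lemma x_less_P: "x n < P n"
proof -
  have "x n ^ 1 \<le> x n ^ j" using x_ge_2[of n] j_ge_1 by (intro power_increasing) auto
  with P_gt[of n] show ?thesis by simp
qed

lemma edge_graph_G: "edge_graph (G n)"
  using prime_P x_ge_2 x_less_P by (rule edge_graph_small_product_graph)

lemma log_cycle_density_G:
  "i \<ge> 1 \<Longrightarrow> log_cycle_density (G n) i = ln (walk_moment (G n) i) - 2 * real i * log_order n"
  using log_cycle_density_eq[OF edge_graph_G] by (simp add: small_product_graph_def)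

lemma log_order_over_log_x_tendsto: "(\<lambda>n. log_order n / log_x n) \<longlonglongrightarrow> real j"
proof (rule tendsto_sandwich)
  have order_pos: "0 < real (P n - 1)" for n using prime_gt_1_nat[OF prime_P, of n] by simp
  have "real j * log_x n \<le> log_order n" for n
  proof -
    have "real (x n ^ j) \<le> real (P n - 1)" using P_gt[of n] by (intro of_nat_mono) simp
    then have "ln (real (x n) ^ j) \<le> log_order n" using x_ge_2[of n] by (intro ln_mono) auto
    then show ?thesis using x_ge_2[of n] by (simp add: ln_realpow)
  qed
  then show "\<forall>\<^sub>F n in sequentially. real j \<le> log_order n / log_x n"
    using log_x_pos by (simp add: pos_le_divide_eq always_eventually)
  have upper: "log_order n \<le> real j * (log_x n + ln 2)" for n
  proof -
    have "(x n + 1) ^ j \<le> (2 * x n) ^ j" using x_ge_2[of n] by (intro power_mono) auto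
    with P_le[of n] have "real (P n - 1) \<le> real ((2 * x n) ^ j)" by (intro of_nat_mono) simp
    then have "log_order n \<le> ln ((2 * real (x n)) ^ j)"
      using order_pos[of n] by (intro ln_mono) auto
    then show ?thesis using x_ge_2[of n] by (simp add: ln_realpow ln_mult_pos algebra_simps)
  qed
  have "log_order n / log_x n \<le> real j * (1 + ln 2 / log_x n)" for n
    using upper[of n] log_x_pos[of n] by (simp add: field_simps)
  then show "\<forall>\<^sub>F n in sequentially. log_order n / log_x n \<le> real j * (1 + ln 2 / log_x n)"
    by (intro always_eventually allI)
  have "(\<lambda>n. real j * (1 + ln 2 / log_x n)) \<longlonglongrightarrow> real j * (1 + 0)"
    by (intro tendsto_intros const_over_log_x_tendsto_0)
  then show "(\<lambda>n. real j * (1 + ln 2 / log_x n)) \<longlonglongrightarrow> real j" by simp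
qed simp

lemma log_edge_density_ge: "log_edge_bound n \<le> log_cycle_density (G n) 1"
proof -
  have order_pos: "real (P n - 1) > 0" using prime_gt_1_nat[OF prime_P, of n] by simp
  have "real (P n - 1) * (real (x n) / 2) \<le> real (P n - 1) * real (x n - 1)"
    using x_ge_2[of n] by (intro mult_left_mono) (auto simp: of_nat_diff)
  also have "\<dots> \<le> walk_moment (G n) 1"
    using of_nat_mono[OF card_parcs_small_product_graph_ge[OF prime_P x_less_P], where 'a = real]
    by (simp only: walk_moment_1_eq_card_parcs[OF pair_graph_small_product_graph] of_nat_mult)
  finally have "ln (real (P n - 1) * (real (x n) / 2)) \<le> ln (walk_moment (G n) 1)"
    using order_pos x_ge_2[of n] by (intro ln_mono) auto
  moreover have "ln (real (P n - 1) * (real (x n) / 2)) = log_order n + (log_x n - ln 2)"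
    using order_pos x_ge_2[of n] by (simp add: ln_mult_pos ln_div)
  ultimately show ?thesis using log_cycle_density_G[of 1 n] by simp
qed

lemma log_cycle_density_ge:
  assumes i_ge_1: "i \<ge> 1"
  shows "(1 - real i) * log_order n + real i * log_edge_bound n \<le> log_cycle_density (G n) i"
    and "2 * real i * log_edge_bound n \<le> log_cycle_density (G n) i"
proof -
  have "real i * log_edge_bound n \<le> real i * log_cycle_density (G n) 1"
    using log_edge_density_ge by (rule mult_left_mono) simp
  moreover have "card (pverts (G n)) = P n - 1" by (simp add: small_product_graph_def)
  ultimately show "(1 - real i) * log_order n + real i * log_edge_bound n \<le>
      log_cycle_density (G n) i"
    and "2 * real i * log_edge_bound n \<le> log_cycle_density (G n) i"
    using log_cycle_density_ge_tangent[OF edge_graph_G i_ge_1, of n]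
      log_cycle_density_sidorenko[OF edge_graph_G i_ge_1, of n] by auto
qed

lemma log_cycle_density_le:
  assumes "1 \<le> i" "i \<le> j"
  shows "log_cycle_density (G n) i \<le>
    (1 - 2 * real i) * log_order n + real i * (log_x n + ln (real (max_divisors (x n ^ i))))"
proof -
  have "x n ^ i \<le> x n ^ j" using x_ge_2[of n] assms by (intro power_increasing) auto
  with P_gt[of n] have "x n ^ i < P n" by simp
  from walk_moment_small_product_graph_le[OF prime_P this]
  have "ln (walk_moment (G n) i) \<le>
      ln (real (P n - 1) * (real (x n) * real (max_divisors (x n ^ i))) ^ i)"
    using walk_moment_pos[OF edge_graph_G] by (intro ln_mono) auto
  also have "\<dots> = log_order n + real i * (log_x n + ln (real (max_divisors (x n ^ i))))"
    using prime_gt_1_nat[OF prime_P, of n] x_ge_2[of n] max_divisors_pos[of "x n ^ i"]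
    by (simp add: ln_mult_pos ln_realpow)
  finally show ?thesis unfolding log_cycle_density_G[OF assms(1)] by (simp add: algebra_simps)
qed

lemma log_max_divisors_over_log_x_tendsto_0:
  assumes "i \<ge> 1"
  shows "(\<lambda>n. ln (real (max_divisors (x n ^ i))) / log_x n) \<longlonglongrightarrow> 0"
proof -
  have "filterlim (\<lambda>n. x n ^ i) at_top sequentially"
    using x_at_top
  proof (rule filterlim_at_top_mono)
    have "x n ^ 1 \<le> x n ^ i" for n using x_ge_2[of n] assms by (intro power_increasing) auto
    then show "\<forall>\<^sub>F n in sequentially. x n \<le> x n ^ i" by simp
  qed
  from filterlim_compose[OF ln_max_divisors_over_ln_tendsto_0 this]
  have "(\<lambda>n. real i * (ln (real (max_divisors (x n ^ i))) / ln (real (x n ^ i)))) \<longlonglongrightarrow> real i * 0"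
    by (rule tendsto_mult_left)
  then show ?thesis using assms x_ge_2 by (simp add: ln_realpow)
qed

lemma log_edge_bound_over_log_x_tendsto: "(\<lambda>n. log_edge_bound n / log_x n) \<longlonglongrightarrow> 1 - real j"
proof -
  have "(\<lambda>n. 1 - ln 2 / log_x n - log_order n / log_x n) \<longlonglongrightarrow> 1 - 0 - real j"
    by (intro tendsto_intros const_over_log_x_tendsto_0 log_order_over_log_x_tendsto)
  moreover have "1 - ln 2 / log_x n - log_order n / log_x n = log_edge_bound n / log_x n" for n
    using log_x_pos[of n] by (simp add: diff_divide_distrib)
  ultimately show ?thesis by simp
qed

lemma log_cycle_density_G_tendsto_if_bounded:
  assumes i_ge_1: "i \<ge> 1" and upper: "\<And>n. log_cycle_density (G n) i / log_x n \<le> b n"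
    and b_limit: "b \<longlonglongrightarrow> small_product_exponent j i"
  shows "(\<lambda>n. log_cycle_density (G n) i / log_x n) \<longlonglongrightarrow> small_product_exponent j i"
proof (rule tendsto_sandwich[OF _ _ _ b_limit])
  let ?a = "\<lambda>n. max ((1 - real i) * (log_order n / log_x n) + real i * (log_edge_bound n / log_x n))
    (2 * real i * (log_edge_bound n / log_x n))"
  have "?a n \<le> log_cycle_density (G n) i / log_x n" for n
    using divide_right_mono[OF log_cycle_density_ge(1)[OF i_ge_1], of "log_x n" n]
      divide_right_mono[OF log_cycle_density_ge(2)[OF i_ge_1], of "log_x n" n] log_x_pos[of n]
    by (simp add: add_divide_distrib)
  then show "\<forall>\<^sub>F n in sequentially. ?a n \<le> log_cycle_density (G n) i / log_x n"
    by (rule always_eventually[OF allI])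
  have "?a \<longlonglongrightarrow> max ((1 - real i) * real j + real i * (1 - real j)) (2 * real i * (1 - real j))"
    by (intro tendsto_intros log_order_over_log_x_tendsto log_edge_bound_over_log_x_tendsto)
  also have "max ((1 - real i) * real j + real i * (1 - real j)) (2 * real i * (1 - real j)) =
      small_product_exponent j i"
    by (simp add: small_product_exponent_def max_def algebra_simps)
  finally show "?a \<longlonglongrightarrow> small_product_exponent j i" .
  show "\<forall>\<^sub>F n in sequentially. log_cycle_density (G n) i / log_x n \<le> b n"
    using upper by (rule always_eventually[OF allI])
qed

lemma log_cycle_density_G_tendsto_short:
  assumes "1 \<le> i" "i \<le> j"
  shows "(\<lambda>n. log_cycle_density (G n) i / log_x n) \<longlonglongrightarrow> small_product_exponent j i"
proof (rule log_cycle_density_G_tendsto_if_bounded[OF assms(1)])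
  let ?b = "\<lambda>n. (1 - 2 * real i) * (log_order n / log_x n) +
    real i * (1 + ln (real (max_divisors (x n ^ i))) / log_x n)"
  show "log_cycle_density (G n) i / log_x n \<le> ?b n" for n
  proof -
    have "log_cycle_density (G n) i / log_x n \<le> ((1 - 2 * real i) * log_order n +
        real i * (log_x n + ln (real (max_divisors (x n ^ i))))) / log_x n"
      using log_cycle_density_le[OF assms] log_x_pos[of n] by (intro divide_right_mono) auto
    also have "\<dots> = ?b n"
      using log_x_pos[of n] by (simp add: add_divide_distrib distrib_left)
    finally show ?thesis .
  qed
  have "?b \<longlonglongrightarrow> (1 - 2 * real i) * real j + real i * (1 + 0)"
    by (intro tendsto_intros log_order_over_log_x_tendsto log_max_divisors_over_log_x_tendsto_0 assms)
  then show "?b \<longlonglongrightarrow> small_product_exponent j i"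
    using assms(2) by (simp add: small_product_exponent_def max_def algebra_simps)
qed

lemma log_cycle_density_G_tendsto:
  assumes "i \<ge> 1"
  shows "(\<lambda>n. log_cycle_density (G n) i / log_x n) \<longlonglongrightarrow> small_product_exponent j i"
proof (cases "i \<le> j")
  case False
  show ?thesis
  proof (rule log_cycle_density_G_tendsto_if_bounded[OF assms])
    let ?b = "\<lambda>n. real i / real j * (log_cycle_density (G n) j / log_x n)"
    show "log_cycle_density (G n) i / log_x n \<le> ?b n" for n
      using log_cycle_density_ratio_antimono[OF edge_graph_G j_ge_1, of i n] False j_ge_1 log_x_pos[of n]
      by (simp add: field_simps)
    have "?b \<longlonglongrightarrow> real i / real j * small_product_exponent j j"
      using log_cycle_density_G_tendsto_short[OF j_ge_1 order.refl] by (rule tendsto_mult_left)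
    also have "real i / real j * small_product_exponent j j = small_product_exponent j i"
      using False j_ge_1 by (simp add: small_product_exponent_def field_simps)
    finally show "?b \<longlonglongrightarrow> small_product_exponent j i" .
  qed
qed (use log_cycle_density_G_tendsto_short[OF assms] in simp)

end

lemma exists_prime_near_power:
  fixes j N :: nat
  assumes "j \<ge> 1"
  obtains P x where "prime P" "x \<ge> N" "x ^ j < P" "P \<le> (x + 1) ^ j"
proof -
  obtain P where P: "prime P" "P > N ^ j" using bigger_prime by blast
  define x where "x = (LEAST x. P \<le> (x + 1) ^ j)"
  have "P \<le> (P + 1) ^ 1" by simp
  also have "\<dots> \<le> (P + 1) ^ j" using assms by (intro power_increasing) auto
  finally have x_upper: "P \<le> (x + 1) ^ j" unfolding x_def by (rule LeastI)
  have x_lower: "x ^ j < P"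
  proof (cases x)
    case 0
    then show ?thesis using assms prime_gt_0_nat[OF P(1)] by (simp add: power_0_left)
  next
    case (Suc y)
    then have "\<not> P \<le> (y + 1) ^ j" unfolding x_def by (intro not_less_Least) simp
    then show ?thesis by (simp add: Suc)
  qed
  have "\<not> x + 1 \<le> N" using power_mono[of "x + 1" N j] P(2) x_upper by auto
  with P(1) x_lower x_upper show thesis by (intro that[of P x]) auto
qed

lemma small_product_graph_sequence_exists:
  assumes "j \<ge> 1"
  shows "\<exists>P x. small_product_graph_sequence j P x"
proof -
  have "\<exists>P x. prime (P :: nat) \<and> x \<ge> n + 2 \<and> x ^ j < P \<and> P \<le> (x + 1) ^ j" for n
    using exists_prime_near_power[OF assms, of "n + 2"] by metis
  then obtain P x :: "nat \<Rightarrow> nat" where Px: "\<And>n. prime (P n)" "\<And>n. x n \<ge> n + 2"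
    "\<And>n. x n ^ j < P n" "\<And>n. P n \<le> (x n + 1) ^ j"
    by metis
  have "n \<le> x n" for n using Px(2)[of n] by simp
  then have "filterlim x at_top sequentially"
    by (intro filterlim_at_top_mono[OF filterlim_ident]) simp
  moreover have "x n \<ge> 2" for n using Px(2)[of n] by simp
  ultimately show ?thesis
    using assms Px by (intro exI[of _ P] exI[of _ x]) (simp add: small_product_graph_sequence_def)
qed

section \<open>The rays of the cone\<close>

definition extreme_ray :: "nat \<Rightarrow> nat \<Rightarrow> real" where
  "extreme_ray j i = (if j = 1 then - real i else small_product_exponent j i)"

definition isolated_edge_graph :: "nat \<Rightarrow> nat pair_pre_digraph" where
  "isolated_edge_graph n = \<lparr> pverts = {..<n + 2}, parcs = {(0, 1), (1, 0)} \<rparr>"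

lemma edge_graph_isolated_edge_graph: "edge_graph (isolated_edge_graph n)"
  by (auto simp: edge_graph_def pair_graph_iff isolated_edge_graph_def sym_def irrefl_def)

lemma log_cycle_density_isolated_edge_graph_tendsto:
  assumes "i \<ge> 1"
  shows "(\<lambda>n. log_cycle_density (isolated_edge_graph n) i / (2 * ln (real (n + 2)))) \<longlonglongrightarrow> - real i"
proof (rule tendsto_sandwich)
  let ?w = "\<lambda>n i. walk_moment (isolated_edge_graph n) i"
  have density: "log_cycle_density (isolated_edge_graph n) i / (2 * ln (real (n + 2))) =
      - real i + ln (?w n i) / (2 * ln (real (n + 2)))" for n
    using log_cycle_density_eq[OF edge_graph_isolated_edge_graph assms, of n]
    by (simp add: isolated_edge_graph_def field_simps)
  have "0 \<le> ln (?w n i)" for n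
    using walk_moment_ge_1[OF edge_graph_isolated_edge_graph assms] by simp
  then show "\<forall>\<^sub>F n in sequentially. - real i \<le>
      log_cycle_density (isolated_edge_graph n) i / (2 * ln (real (n + 2)))"
    unfolding density by simp
  have upper: "ln (?w n i) \<le> real i * ln 2" for n
  proof -
    have "?w n 1 = real (card (parcs (isolated_edge_graph n)))"
      using edge_graph_isolated_edge_graph[of n]
      by (intro walk_moment_1_eq_card_parcs) (simp add: edge_graph_def)
    then have "?w n 1 = 2" by (simp add: isolated_edge_graph_def)
    then show ?thesis
      using ln_walk_moment_ratio_antimono[OF edge_graph_isolated_edge_graph order.refl assms, of n]
      by simp
  qed
  have "ln (?w n i) / (2 * ln (real (n + 2))) \<le> real i * ln 2 / (2 * ln (real (n + 2)))" for n
    using upper by (intro divide_right_mono) auto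
  then show "\<forall>\<^sub>F n in sequentially. log_cycle_density (isolated_edge_graph n) i / (2 * ln (real (n + 2))) \<le>
      - real i + real i * ln 2 / (2 * ln (real (n + 2)))"
    unfolding density by simp
  show "(\<lambda>n. - real i + real i * ln 2 / (2 * ln (real (n + 2)))) \<longlonglongrightarrow> - real i"
    by real_asymp
qed simp

lemma extreme_ray_is_limit:
  assumes "j \<ge> 1"
  shows "\<exists>(T :: nat \<Rightarrow> nat pair_pre_digraph) X. (\<forall>n. edge_graph (T n) \<and> X n > 0) \<and>
    (\<forall>i\<ge>1. (\<lambda>n. log_cycle_density (T n) i / X n) \<longlonglongrightarrow> extreme_ray j i)"
proof (cases "j = 1")
  case True
  then show ?thesis
    using edge_graph_isolated_edge_graph log_cycle_density_isolated_edge_graph_tendsto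
    by (intro exI[of _ isolated_edge_graph] exI[of _ "\<lambda>n. 2 * ln (real (n + 2))"])
      (simp add: extreme_ray_def)
next
  case False
  obtain P x where "small_product_graph_sequence j P x"
    using small_product_graph_sequence_exists[OF assms] by blast
  then interpret small_product_graph_sequence j P x .
  show ?thesis
    using False edge_graph_G log_x_pos log_cycle_density_G_tendsto
    by (intro exI[of _ G] exI[of _ log_x]) (simp add: extreme_ray_def)
qed

text \<open>The cone is simplicial: \<open>facet k j\<close> is the defining functional that vanishes on all extreme
  rays but the \<open>j\<close>-th, scaled so that it takes the value 1 there.\<close>

definition facet :: "nat \<Rightarrow> nat \<Rightarrow> (nat \<Rightarrow> real) \<Rightarrow> real" where
  "facet k j z =
     (if j = 1 then z k / real k - 2 * z 1
      else if j = k then z (k - 1) - (real k - 1) / real k * z k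
      else z (j - 1) - 2 * z j + z (j + 1))"

lemma facet_cong:
  assumes "k \<ge> 2" "j \<in> {1..k}" "\<And>i. i \<in> {1..k} \<Longrightarrow> z i = z' i"
  shows "facet k j z = facet k j z'"
proof -
  have "z 1 = z' 1" "z k = z' k" "z (k - 1) = z' (k - 1)" "z j = z' j"
    "j \<noteq> 1 \<Longrightarrow> z (j - 1) = z' (j - 1)" "j \<noteq> k \<Longrightarrow> z (j + 1) = z' (j + 1)"
    using assms(1,2) by (auto intro!: assms(3))
  then show ?thesis by (simp add: facet_def)
qed

lemma facet_diff: "facet k j (\<lambda>i. z i - z' i) = facet k j z - facet k j z'"
  by (simp add: facet_def diff_divide_distrib algebra_simps)

lemma facet_scale: "facet k j (\<lambda>i. c * z i) = c * facet k j z"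
  by (simp add: facet_def algebra_simps)

lemma facet_sum: "facet k j (\<lambda>i. \<Sum>m\<in>M. f m i) = (\<Sum>m\<in>M. facet k j (f m))"
  by (simp add: facet_def sum.distrib sum_subtractf sum_divide_distrib sum_distrib_left)

lemma facet_extreme_ray:
  assumes "k \<ge> 2" "j \<in> {1..k}" "m \<in> {1..k}"
  shows "facet k j (extreme_ray m) = of_bool (j = m)"
proof -
  consider "j = 1" | "j = k" "j \<noteq> 1" | "1 < j" "j < k" using assms(2) by force
  then show ?thesis
  proof cases
    case 1
    then show ?thesis
      using assms
      by (auto simp: facet_def extreme_ray_def small_product_exponent_def max_def field_simps)
  next
    case 2
    obtain n where k_eq: "k = Suc n" "n \<ge> 1" using assms(1) by (cases k) auto
    have "m \<le> n \<or> m = Suc n" using assms(3) k_eq(1) by auto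
    then show ?thesis
      by (elim disjE)
        (use 2 k_eq in \<open>auto simp: facet_def extreme_ray_def small_product_exponent_def max_def field_simps\<close>)
  next
    case 3
    obtain n where j_eq: "j = Suc n" "n \<ge> 1" using 3(1) by (cases j) auto
    consider "m \<le> n" | "m = Suc n" | "m \<ge> Suc (Suc n)" by linarith
    then show ?thesis
      by cases
        (use 3 j_eq in \<open>auto simp: facet_def extreme_ray_def small_product_exponent_def max_def algebra_simps\<close>)
  qed
qed

lemma affine_if_second_difference_eq_0:
  fixes d :: "nat \<Rightarrow> real"
  assumes "\<And>j. 1 < j \<Longrightarrow> j < k \<Longrightarrow> d (j - 1) - 2 * d j + d (j + 1) = 0" "Suc m \<le> k"
  shows "d (Suc m) = d 1 + real m * (d 2 - d 1)"
  using assms(2)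
proof (induction m rule: less_induct)
  case (less m)
  consider "m = 0" | "m = 1" | n where "m = Suc (Suc n)" by (metis One_nat_def nat.exhaust)
  then show ?case
  proof cases
    case (3 n)
    have "d (Suc n) - 2 * d (Suc (Suc n)) + d (Suc (Suc (Suc n))) = 0"
      using assms(1)[of "Suc (Suc n)"] less.prems 3 by simp
    moreover have "d (Suc n) = d 1 + real n * (d 2 - d 1)"
      "d (Suc (Suc n)) = d 1 + real (Suc n) * (d 2 - d 1)"
      using less.IH[of n] less.IH[of "Suc n"] less.prems 3 by auto
    ultimately show ?thesis using 3 by (simp add: algebra_simps)
  qed (auto simp: numeral_2_eq_2)
qed

lemma eq_0_if_facets_eq_0:
  assumes k_ge_2: "k \<ge> 2" and facets: "\<And>j. j \<in> {1..k} \<Longrightarrow> facet k j d = 0" and i_range: "i \<in> {1..k}"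
  shows "d i = 0"
proof -
  have second: "d (j - 1) - 2 * d j + d (j + 1) = 0" if "1 < j" "j < k" for j
    using facets[of j] that by (simp add: facet_def)
  have affine: "d (Suc m) = d 1 + real m * (d 2 - d 1)" if "Suc m \<le> k" for m
    using second that by (rule affine_if_second_difference_eq_0)
  obtain n where n: "k = Suc (Suc n)" using k_ge_2 by (metis add_2_eq_Suc le_Suc_ex)
  have ends: "d k = d 1 + real (Suc n) * (d 2 - d 1)" "d (k - 1) = d 1 + real n * (d 2 - d 1)"
    using affine[of "Suc n"] affine[of n] n by auto
  have "real k * d (k - 1) = (real k - 1) * d k"
    using facets[of k] k_ge_2 by (simp add: facet_def field_simps)
  then have "d 2 = 2 * d 1" unfolding ends by (simp add: n algebra_simps)
  moreover have "d k = 2 * real k * d 1"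
    using facets[of 1] k_ge_2 by (simp add: facet_def field_simps)
  ultimately have "real k * d 1 = 0" using ends(1) by (simp add: n algebra_simps)
  then have "d 1 = 0" using k_ge_2 by simp
  with \<open>d 2 = 2 * d 1\<close> affine[of "i - 1"] i_range show ?thesis by auto
qed

lemma extreme_ray_decomposition:
  assumes k_ge_2: "k \<ge> 2" and i_range: "i \<in> {1..k}"
  shows "z i = (\<Sum>m\<in>{1..k}. facet k m z * extreme_ray m i)"
proof -
  have "facet k j (\<lambda>i. z i - (\<Sum>m\<in>{1..k}. facet k m z * extreme_ray m i)) = 0" if j: "j \<in> {1..k}" for j
  proof -
    have "(\<Sum>m\<in>{1..k}. facet k m z * facet k j (extreme_ray m)) =
        (\<Sum>m\<in>{1..k}. if m = j then facet k j z else 0)"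
      using k_ge_2 j by (intro sum.cong) (auto simp: facet_extreme_ray)
    then show ?thesis using j by (simp add: facet_diff facet_sum facet_scale)
  qed
  from eq_0_if_facets_eq_0[OF k_ge_2 this i_range] show ?thesis by simp
qed

lemma Q_cone_iff_facets:
  assumes "k \<ge> 2" "y \<in> topspace (Euclidean_space k)"
  shows "y \<in> Q_cone k \<longleftrightarrow> (\<forall>j\<in>{1..k}. 0 \<le> facet k j (\<lambda>i. y (i - 1)))"
proof -
  have "(\<forall>i. 1 \<le> i \<and> i \<le> k - 2 \<longrightarrow> 0 \<le> y (i - 1) - 2 * y i + y (i + 1)) \<longleftrightarrow>
      (\<forall>j\<in>{2..k - 1}. 0 \<le> facet k j (\<lambda>i. y (i - 1)))" (is "?convex \<longleftrightarrow> _")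
  proof -
    have "facet k (Suc i) (\<lambda>i. y (i - 1)) = y (i - 1) - 2 * y i + y (i + 1)" if "i \<in> {1..k - 2}" for i
      using that assms(1) by (auto simp: facet_def)
    then have "?convex \<longleftrightarrow> (\<forall>i\<in>{1..k - 2}. 0 \<le> facet k (Suc i) (\<lambda>i. y (i - 1)))" by auto
    moreover have "{2..k - 1} = Suc ` {1..k - 2}"
      using assms(1) by (simp add: numeral_2_eq_2 Suc_diff_Suc)
    ultimately show ?thesis by (simp only: ball_simps)
  qed
  moreover have "0 \<le> 2 * real k * y (k - 2) - (2 * real k - 2) * y (k - 1) \<longleftrightarrow>
      0 \<le> facet k k (\<lambda>i. y (i - 1))" (is "0 \<le> ?norm \<longleftrightarrow> _")
  proof -
    have "?norm = 2 * real k * facet k k (\<lambda>i. y (i - 1))"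
      using assms(1) by (simp add: facet_def numeral_2_eq_2 field_simps)
    then show ?thesis using assms(1) by (simp only: zero_le_mult_iff) simp
  qed
  moreover have "0 \<le> - 2 * real k * y 0 + y (k - 1) \<longleftrightarrow> 0 \<le> facet k 1 (\<lambda>i. y (i - 1))"
    using assms(1) by (simp add: facet_def field_simps)
  moreover have "{1..k} = insert 1 (insert k {2..k - 1})" using assms(1) by auto
  ultimately show ?thesis using assms(2) unfolding Q_cone_def by (simp add: conj_ac)
qed

lemma continuous_on_facet:
  assumes "k > 0"
  shows "continuous_on UNIV (\<lambda>y. facet k j (\<lambda>i. y (i - 1)))"
proof -
  consider "j = 1" | "j = k" "j \<noteq> 1" | "j \<noteq> 1" "j \<noteq> k" by blast
  then show ?thesis
    by cases
      (use assms in \<open>auto simp: facet_def intro!: continuous_intros continuous_on_product_coordinates\<close>)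
qed

lemma closedin_Q_cone:
  assumes "k \<ge> 2"
  shows "closedin (Euclidean_space k) (Q_cone k)"
proof -
  let ?E = "topspace (Euclidean_space k)"
  have "Q_cone k = ?E \<inter> (\<Inter>j\<in>{1..k}. {y. 0 \<le> facet k j (\<lambda>i. y (i - 1))})"
    using Q_cone_iff_facets[OF assms] by (auto simp: Q_cone_def)
  moreover have "closed (\<Inter>j\<in>{1..k}. {y. 0 \<le> facet k j (\<lambda>i. y (i - 1))})"
    by (intro closed_INT ballI closed_Collect_le continuous_on_const continuous_on_facet)
      (use assms in simp)
  moreover have "closed ?E"
    using closedin_topspace by (rule closedin_Euclidean_imp_closed)
  ultimately show ?thesis by (auto simp: closedin_Euclidean_space_iff)
qed

section \<open>The tropicalization of the even cycles\<close>

lemma length_even_cycles: "length (even_cycles k) = k"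
  by (simp add: even_cycles_def)

lemma density_vector_even_cycles:
  "i < k \<Longrightarrow> density_vector (even_cycles k) T i = hom_density (cycle_graph (2 * (i + 1))) T"
  by (simp add: density_vector_def even_cycles_def del: upt_Suc)

lemma pair_wf_digraph_even_cycles: "H \<in> set (even_cycles k) \<Longrightarrow> pair_wf_digraph H"
  by (auto simp: even_cycles_def pair_wf_digraph_def cycle_graph_def)

lemma facet_log_cycle_density_nonneg:
  assumes "edge_graph T" "k \<ge> 2" "j \<in> {1..k}"
  shows "0 \<le> facet k j (log_cycle_density T)"
proof -
  consider "j = 1" | "j = k" "j \<noteq> 1" | "1 < j" "j < k" using assms(3) by force
  then show ?thesis
  proof cases
    case 1
    then show ?thesis
      using log_cycle_density_sidorenko[OF assms(1), of k] assms(2)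
      by (simp add: facet_def field_simps)
  next
    case 2
    then show ?thesis
      using log_cycle_density_ratio_antimono[OF assms(1), of "k - 1" k] assms(2)
      by (simp add: facet_def of_nat_diff field_simps)
  next
    case 3
    then obtain n where "j = Suc n" "n \<ge> 1" by (cases j) auto
    with 3 show ?thesis
      using log_cycle_density_convex[OF assms(1), of n] by (simp add: facet_def)
  qed
qed

lemma log_image_graph_density_vectors_subset_Q_cone:
  assumes "k \<ge> 2" "b > 1"
  shows "log_image k b (graph_density_vectors (even_cycles k)) \<subseteq> Q_cone k"
proof
  fix y assume "y \<in> log_image k b (graph_density_vectors (even_cycles k))"
  then obtain T :: "nat pair_pre_digraph" where T: "pair_graph T"
    and pos: "\<And>i. i < k \<Longrightarrow> density_vector (even_cycles k) T i > 0"
    and y: "y = zero_extend k (\<lambda>i. log b (density_vector (even_cycles k) T i))"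
    unfolding log_image_def graph_density_vectors_def by blast
  have "walk_moment T 1 \<noteq> 0"
    using pos[of 0] assms(1) hom_density_even_cycle[OF T, of 1]
    by (auto simp: density_vector_even_cycles)
  then have T_edge: "edge_graph T"
    using T walk_moment_1_eq_card_parcs[OF T] by (auto simp: edge_graph_def)
  have "0 \<le> facet k j (\<lambda>i. y (i - 1))" if j: "j \<in> {1..k}" for j
  proof -
    have "facet k j (\<lambda>i. y (i - 1)) = facet k j (\<lambda>i. 1 / ln b * log_cycle_density T i)"
      using assms(1) j
      by (rule facet_cong) (auto simp: y density_vector_even_cycles log_cycle_density_def log_def)
    also have "\<dots> = 1 / ln b * facet k j (log_cycle_density T)"
      by (rule facet_scale)
    finally show ?thesis using facet_log_cycle_density_nonneg[OF T_edge assms(1) j] assms(2) by simp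
  qed
  moreover have "y \<in> topspace (Euclidean_space k)" by (simp add: y topspace_Euclidean_space)
  ultimately show "y \<in> Q_cone k" using Q_cone_iff_facets[OF assms(1)] by blast
qed

lemma log_image_density_profile_subset_Q_cone:
  assumes "k \<ge> 2" "b > 1"
  shows "log_image k b (density_profile (even_cycles k)) \<subseteq> Q_cone k"
proof -
  have "log_image k b (density_profile (even_cycles k)) \<subseteq>
      Euclidean_space k closure_of log_image k b (graph_density_vectors (even_cycles k))"
    unfolding density_profile_eq_closure length_even_cycles by (rule log_image_closure_of)
  also have "\<dots> \<subseteq> Q_cone k"
    using log_image_graph_density_vectors_subset_Q_cone[OF assms] closedin_Q_cone[OF assms(1)]
    by (rule closure_of_minimal)
  finally show ?thesis .
qed

lemma scaled_extreme_ray_in_lower_trop: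
  assumes "c \<ge> 0" "j \<ge> 1"
  shows "zero_extend k (\<lambda>i. c * extreme_ray j (i + 1)) \<in> lower_trop k (density_profile (even_cycles k))"
proof -
  obtain T :: "nat \<Rightarrow> nat pair_pre_digraph" and X where T: "\<And>n. edge_graph (T n)" and X: "\<And>n. X n > 0"
    and limit: "\<And>i. i \<ge> 1 \<Longrightarrow> (\<lambda>n. log_cycle_density (T n) i / X n) \<longlonglongrightarrow> extreme_ray j i"
    using extreme_ray_is_limit[OF assms(2)] by blast
  show ?thesis
  proof (rule lower_trop_limit_scaled_ln)
    show "mult_closed (density_profile (even_cycles k))"
      using pair_wf_digraph_even_cycles by (rule mult_closed_density_profile)
    show "density_vector (even_cycles k) (T n) \<in> density_profile (even_cycles k)" for n
    proof -
      have "pair_graph (T n)" "pverts (T n) \<noteq> {}"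
        using T[of n] edge_graph_card_pos[OF T[of n]] by (auto simp: edge_graph_def)
      with pair_wf_digraph_even_cycles show ?thesis
        using density_vector_in_graph_density_vectors graph_density_vectors_subset_profile by blast
    qed
    show "density_vector (even_cycles k) (T n) i > 0" if "i < k" for n i
      unfolding density_vector_even_cycles[OF that] using T
      by (rule hom_density_even_cycle_pos) simp
    show "c / X n \<ge> 0" for n using assms(1) X[of n] by simp
    show "(\<lambda>n. c / X n * ln (density_vector (even_cycles k) (T n) i)) \<longlonglongrightarrow> c * extreme_ray j (i + 1)"
      if "i < k" for i
      using tendsto_mult_left[OF limit[of "i + 1"], of c] that
      by (simp add: density_vector_even_cycles log_cycle_density_def)
  qed
qed

lemma Q_cone_subset_lower_trop:
  assumes k_ge_2: "k \<ge> 2"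
  shows "Q_cone k \<subseteq> lower_trop k (density_profile (even_cycles k))"
proof
  fix y assume y: "y \<in> Q_cone k"
  then have y_in_space: "y \<in> topspace (Euclidean_space k)" by (simp add: Q_cone_def)
  define c where "c j = facet k j (\<lambda>i. y (i - 1))" for j
  have c_nonneg: "c j \<ge> 0" if "j \<in> {1..k}" for j
    using y that Q_cone_iff_facets[OF k_ge_2 y_in_space] by (simp add: c_def)
  let ?ray = "\<lambda>j. zero_extend k (\<lambda>i. c j * extreme_ray j (i + 1))"
  have "(\<lambda>i. \<Sum>j\<in>{1..k}. ?ray j i) \<in> lower_trop k (density_profile (even_cycles k))"
    using c_nonneg k_ge_2
    by (intro lower_trop_sum mult_closed_density_profile pair_wf_digraph_even_cycles
        scaled_extreme_ray_in_lower_trop) auto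
  also have "(\<lambda>i. \<Sum>j\<in>{1..k}. ?ray j i) = zero_extend k (\<lambda>i. \<Sum>j\<in>{1..k}. c j * extreme_ray j (i + 1))"
    by auto
  also have "\<dots> = y"
    using y_in_space
  proof (rule zero_extend_eq)
    show "(\<Sum>j\<in>{1..k}. c j * extreme_ray j (i + 1)) = y i" if "i < k" for i
      using extreme_ray_decomposition[OF k_ge_2, of "i + 1" "\<lambda>i. y (i - 1)"] that
      by (simp add: c_def)
  qed
  finally show "y \<in> lower_trop k (density_profile (even_cycles k))" .
qed

theorem theorem4p3:
  fixes k :: nat
  assumes "k \<ge> 2"
  shows "(\<exists>L. is_trop k (density_profile (even_cycles k)) L) \<and>
    trop k (density_profile (even_cycles k)) = Q_cone k"
proof -
  have "is_trop k (density_profile (even_cycles k)) (Q_cone k)"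
    using closedin_Q_cone[OF assms] log_image_density_profile_subset_Q_cone[OF assms]
      Q_cone_subset_lower_trop[OF assms]
    by (rule is_tropI)
  then show ?thesis using trop_eqI by blast
qed

end
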